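(* Let $d\ge1$, let $p\ge 1$ be an integer, and let $\{S_m\}_{m\ge0}$ be any random walk on $\mathbb{Z}^d$ started at $0$. Let $J_n^{(p)}$ (respectively $J_n^{p}$) be the number of inner boundary points of the range $\{S_m\}_{m=0}^n$ that are visited exactly $p$ times (respectively at least $p$ times) during times $0,\dots,n$. Then, almost surely, $$\lim_{n\to\infty}\frac{J_n^{(p)}}{n}=P\Big(\{S_m\}_{m=0}^{\infty}\cup\{S'_m\}_{m=0}^{\infty}\cup\bigcup_{i=1}^{p-1}\{S^i_m\}_{m=0}^{T_{0,i}}\not\supset\mathcal{N}(0),\ \ 0\notin\{S_m\}_{m=1}^{\infty}\cup\{S'_m\}_{m=1}^{\infty},\ \text{ and } 0\in\{S^i_m\}_{m=1}^{\infty}\text{ for } i=1,\dots,p-1\Big),$$ and, almost surely, $$\lim_{n\to\infty}\frac{J_n^{p}}{n}=P\Big(\{S_m\}_{m=0}^{\infty}\cup\{S'_m\}_{m=0}^{\infty}\cup\bigcup_{i=1}^{p-1}\{S^i_m\}_{m=0}^{T_{0,i}}\not\supset\mathcal{N}(0),\ \ 0\notin\{S_m\}_{m=1}^{\infty},\ \text{ and } 0\in\{S^i_m\}_{m=1}^{\infty}\text{ for } i=1,\dots,p-1\Big).$$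
   Context: Random walk: $X_1,X_2,\dots$ are i.i.d. $\mathbb{Z}^d$-valued random variables (with an arbitrary common law), $S_0=0$ and $S_k=\sum_{i=1}^k X_i$; $P$ denotes the underlying probability law. For $a\in\mathbb{Z}^d$, $\mathcal{N}(a)=\{z\in\mathbb{Z}^d:\mathrm{dist}(a,z)=1\}$ is the set of the $2d$ nearest neighbors of $a$ in the lattice $\mathbb{Z}^d$ ($\mathrm{dist}$ is Euclidean distance). The inner boundary of the range $\{S_m\}_{m=0}^n$ is the set of points $H_n=\{S_i:0\le i\le n,\ \{S_m\}_{m=0}^n\not\supset\mathcal{N}(S_i)\}$. With $\sharp$ denoting cardinality, $$J_n^{p}=\sharp\{S_i\in H_n:\sharp\{m:0\le m\le n,\ S_m=S_i\}\ge p\},\qquad J_n^{(p)}=\sharp\{S_i\in H_n:\sharp\{m:0\le m\le n,\ S_m=S_i\}=p\}$$ (these count distinct points). The processes $\{S^i_m\}_{m\ge0}$, $i\ge1$, are copies of $\{S_m\}_{m\ge0}$, and $\{S'_m\}_{m\ge0}$ (the dual walk) has the law of $\{-S_m\}_{m\ge0}$; the processes $S,S',S^1,S^2,\dots$ are mutually independent. $T_{a,i}=\inf\{m\ge1:S^i_m=a\}$. Notation such as $\{S_m\}_{m=0}^{\infty}$ inside set relations denotes the set of sites visited; for $p=1$ the union over $i$ is empty and the condition on the $S^i$ is vacuous. *)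

theory Defs
  imports "HOL-Probability.Probability" "HOL-Library.Extended_Nat"
begin

text \<open>
  Sites of the \<open>d\<close>-dimensional lattice have type \<open>int ^ 'd\<close>. As \<^typ>\<open>int\<close> carries no metric in the
  library, the Euclidean distance is taken after embedding the lattice into \<open>real ^ 'd\<close>.
\<close>

definition embed :: "int ^ 'd \<Rightarrow> real ^ 'd" where
  "embed z = (\<chi> i. real_of_int (z $ i))"

definition nbhd :: "int ^ 'd \<Rightarrow> (int ^ 'd) set" where
  "nbhd a = {z. dist (embed a) (embed z) = 1}"

definition inner_boundary :: "(nat \<Rightarrow> int ^ 'd) \<Rightarrow> nat \<Rightarrow> (int ^ 'd) set" where
  "inner_boundary s n = {s i | i. i \<le> n \<and> \<not> nbhd (s i) \<subseteq> s ` {0..n}}"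

definition visits :: "(nat \<Rightarrow> int ^ 'd) \<Rightarrow> nat \<Rightarrow> int ^ 'd \<Rightarrow> nat" where
  "visits s n x = card {m. m \<le> n \<and> s m = x}"

definition J_atleast :: "nat \<Rightarrow> (nat \<Rightarrow> int ^ 'd) \<Rightarrow> nat \<Rightarrow> nat" where
  "J_atleast p s n = card {x \<in> inner_boundary s n. visits s n x \<ge> p}"

definition J_exactly :: "nat \<Rightarrow> (nat \<Rightarrow> int ^ 'd) \<Rightarrow> nat \<Rightarrow> nat" where
  "J_exactly p s n = card {x \<in> inner_boundary s n. visits s n x = p}"

text \<open>The infimum is taken in \<^typ>\<open>enat\<close>, so it is \<open>\<infinity>\<close> if the site is never hit.\<close>

definition hitting_time :: "int ^ 'd \<Rightarrow> (nat \<Rightarrow> int ^ 'd) \<Rightarrow> enat" where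
  "hitting_time a s = Inf {enat m | m. m \<ge> 1 \<and> s m = a}"

definition sites_upto :: "(nat \<Rightarrow> int ^ 'd) \<Rightarrow> enat \<Rightarrow> (int ^ 'd) set" where
  "sites_upto s t = {s m | m. enat m \<le> t}"

definition iid :: "'a measure \<Rightarrow> (nat \<Rightarrow> 'a \<Rightarrow> int ^ 'd) \<Rightarrow> bool" where
  "iid M X \<longleftrightarrow>
     prob_space.indep_vars M (\<lambda>_. count_space UNIV) X {1..} \<and>
     (\<forall>i\<ge>1. distr M (count_space UNIV) (X i) = distr M (count_space UNIV) (X 1))"

definition walk :: "(nat \<Rightarrow> 'a \<Rightarrow> int ^ 'd) \<Rightarrow> 'a \<Rightarrow> nat \<Rightarrow> int ^ 'd" where
  "walk X \<omega> k = (\<Sum>i=1..k. X i \<omega>)"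

definition path_space :: "(nat \<Rightarrow> int ^ 'd) measure" where
  "path_space = Pi\<^sub>M UNIV (\<lambda>_. count_space UNIV)"

datatype label = Original | Dual | Copy nat

text \<open>
  The dual walk \<open>S'\<close> and the copies \<open>C i\<close>, \<open>i \<ge> 1\<close>, are specified by their laws on the path space
  and live on the same probability space as the walk \<open>S\<close>. Measurability of all the processes is
  part of \<^const>\<open>prob_space.indep_vars\<close>.
\<close>

definition aux_walks ::
  "'a measure \<Rightarrow> ('a \<Rightarrow> nat \<Rightarrow> int ^ 'd) \<Rightarrow> ('a \<Rightarrow> nat \<Rightarrow> int ^ 'd) \<Rightarrow>
     (nat \<Rightarrow> 'a \<Rightarrow> nat \<Rightarrow> int ^ 'd) \<Rightarrow> bool" where
  "aux_walks M S S' C \<longleftrightarrow>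
     prob_space.indep_vars M (\<lambda>_. path_space)
       (\<lambda>l. case l of Original \<Rightarrow> S | Dual \<Rightarrow> S' | Copy i \<Rightarrow> C i)
       ({Original, Dual} \<union> Copy ` {1..}) \<and>
     distr M path_space S' = distr M path_space (\<lambda>\<omega> m. - S \<omega> m) \<and>
     (\<forall>i\<ge>1. distr M path_space (C i) = distr M path_space S)"

end

theory Submission
  imports Defs
begin

text \<open>
  Every boundary site counted at time \<open>n\<close> is represented by its \<open>p\<close>-th visit from the end. Whether a
  time \<open>i\<close> is such a representative depends on the future of the walk after \<open>i\<close> and, through the
  visited neighbours, on its past. Looking only \<open>k\<close> steps into the past makes it a function of the
  shifted increment sequence, to which the pointwise ergodic theorem applies. The truncation error is
  controlled by times \<open>j\<close> whose site is next revisited only after more than \<open>k\<close> steps, or for which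
  the site or a neighbour of it is visited after time \<open>j + k\<close>, but only finitely often. Erroneous
  times can be charged to such \<open>j\<close> with bounded multiplicity, and the frequency of these \<open>j\<close> vanishes
  as \<open>k\<close> grows. This needs no distinction between recurrence and transience.

  Reversing the first \<open>k\<close> increments turns the truncated past into an independent dual walk, so the
  limit is the probability that a walk returns to \<open>0\<close> exactly \<open>p - 1\<close> times and, together with the dual
  walk, misses a neighbour of \<open>0\<close>. By inclusion-exclusion it is determined by the probabilities of
  avoiding given sets of neighbours, and these factorize at the successive returns to \<open>0\<close> into
  \<open>p - 1\<close> independent excursions and a final escape.
\<close>

section \<open>The pointwise ergodic theorem for bounded functions\<close>

text \<open>The maximum over 0 <= k <= n of the sum of \<open>h\<close> along the first k points of
  the orbit, the empty sum included. The recursive form yields the key inequality of the maximal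
  ergodic theorem directly.\<close>

primrec maxsum :: "('a \<Rightarrow> 'a) \<Rightarrow> ('a \<Rightarrow> real) \<Rightarrow> nat \<Rightarrow> 'a \<Rightarrow> real" where
  "maxsum T h 0 x = 0"
| "maxsum T h (Suc n) x = max 0 (h x + maxsum T h n (T x))"

lemma maxsum_nonneg: "0 \<le> maxsum T h n x"
  by (cases n) auto

lemma maxsum_mono_Suc: "maxsum T h n x \<le> maxsum T h (Suc n) x"
proof (induction n arbitrary: x)
  case (Suc n)
  show ?case using Suc[of "T x"] by (simp del: maxsum.simps(2) add: maxsum.simps(2)[of _ _ n] maxsum.simps(2)[of _ _ "Suc n"])
qed (simp add: maxsum_nonneg)

lemma maxsum_mono: "m \<le> n \<Longrightarrow> maxsum T h m x \<le> maxsum T h n x"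
  by (rule lift_Suc_mono_le[of "\<lambda>n. maxsum T h n x"]) (auto intro: maxsum_mono_Suc simp del: maxsum.simps)

lemma sum_funpow_Suc:
  fixes h :: "'a \<Rightarrow> 'b::comm_monoid_add"
  shows "(\<Sum>i<Suc n. h ((T ^^ i) x)) = h x + (\<Sum>i<n. h ((T ^^ i) (T x)))"
  by (subst sum.lessThan_Suc_shift) (simp add: funpow_swap1)

lemma sum_le_maxsum: "(\<Sum>i<n. h ((T ^^ i) x)) \<le> maxsum T h n x"
proof (induction n arbitrary: x)
  case (Suc n)
  show ?case using Suc[of "T x"] unfolding sum_funpow_Suc by simp
qed simp

lemma maxsum_le_bound:
  assumes "\<And>x. \<bar>h x\<bar> \<le> B" shows "maxsum T h n x \<le> real n * B"
proof (induction n arbitrary: x)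
  case (Suc n)
  have "0 \<le> B" "h x \<le> B" using assms[of x] by auto
  then show ?case using Suc[of "T x"] by (auto simp: algebra_simps intro: add_nonneg_nonneg)
qed simp

lemma maxsum_pos_imp: "maxsum T h n x > 0 \<Longrightarrow> \<exists>k\<le>n. (\<Sum>i<k. h ((T ^^ i) x)) = maxsum T h n x"
proof (induction n arbitrary: x)
  case (Suc n)
  have eq: "maxsum T h (Suc n) x = h x + maxsum T h n (T x)" using Suc.prems by (auto simp: max_def split: if_splits)
  show ?case
  proof (cases "maxsum T h n (T x) > 0")
    case True
    then obtain k where "k \<le> n" "(\<Sum>i<k. h ((T ^^ i) (T x))) = maxsum T h n (T x)" using Suc.IH by blast
    then have "Suc k \<le> Suc n \<and> (\<Sum>i<Suc k. h ((T ^^ i) x)) = maxsum T h (Suc n) x" unfolding sum_funpow_Suc eq by simp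
    then show ?thesis by blast
  next
    case False
    then have "maxsum T h n (T x) = 0" using maxsum_nonneg[of T h n "T x"] by simp
    then have "Suc 0 \<le> Suc n \<and> (\<Sum>i<Suc 0. h ((T ^^ i) x)) = maxsum T h (Suc n) x" unfolding eq by simp
    then show ?thesis by blast
  qed
qed simp

context prob_space
begin

text \<open>Garsia's argument. Where the running maximum is positive, its recursion bounds
  \<open>h x\<close> from below by \<open>maxsum T h n x - maxsum T h n (T x)\<close>; elsewhere
  this difference is at most 0. The difference has integral 0 because \<open>T\<close> preserves the
  measure.\<close>

lemma maximal_ergodic:
  fixes T :: "'a \<Rightarrow> 'a" and h :: "'a \<Rightarrow> real"
  assumes T[measurable]: "T \<in> M \<rightarrow>\<^sub>M M" and inv: "distr M M T = M"
    and h[measurable]: "h \<in> borel_measurable M" and bd: "\<And>x. \<bar>h x\<bar> \<le> B"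
  shows "0 \<le> (\<integral>x. indicator {x. \<exists>n. (\<Sum>i<n. h ((T ^^ i) x)) > 0} x * h x \<partial>M)"
proof -
  have m[measurable]: "maxsum T h n \<in> borel_measurable M" for n
  proof (induction n)
    case (Suc n)
    note Suc[measurable]
    have "maxsum T h (Suc n) = (\<lambda>x. max 0 (h x + maxsum T h n (T x)))" by auto
    then show ?case by simp
  qed simp
  have int: "integrable M (maxsum T h n)" for n
    by (rule integrable_const_bound[where B="real n * B"])
      (auto intro!: AE_I2 maxsum_le_bound[OF bd] simp: maxsum_nonneg)
  have inth: "integrable M h" by (rule integrable_const_bound[where B=B]) (use bd in auto)
  have fin: "0 \<le> (\<integral>x. indicator {x. maxsum T h n x > 0} x * h x \<partial>M)" for n
  proof (cases n)
    case (Suc k)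
    have le: "maxsum T h n x - maxsum T h n (T x) \<le> indicator {x. maxsum T h n x > 0} x * h x" for x
    proof (cases "maxsum T h n x > 0")
      case True
      then have "maxsum T h n x = h x + maxsum T h k (T x)" by (auto simp: Suc max_def split: if_splits)
      moreover have "maxsum T h k (T x) \<le> maxsum T h n (T x)" by (rule maxsum_mono) (simp add: Suc)
      ultimately show ?thesis using True by simp
    next
      case False
      then show ?thesis using maxsum_nonneg[of T h n x] maxsum_nonneg[of T h n "T x"] by auto
    qed
    have intT: "integrable M (\<lambda>x. maxsum T h n (T x))"
      using integrable_distr_eq[OF T m[of n]] int[of n] inv by simp
    have "(\<integral>x. maxsum T h n (T x) \<partial>M) = (\<integral>x. maxsum T h n x \<partial>distr M M T)"
      by (rule integral_distr[symmetric]) auto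
    then have "0 = (\<integral>x. maxsum T h n x - maxsum T h n (T x) \<partial>M)"
      using inv int intT by simp
    also have "\<dots> \<le> (\<integral>x. indicator {x. maxsum T h n x > 0} x * h x \<partial>M)"
    proof (rule integral_mono[OF Bochner_Integration.integrable_diff[OF int intT] _ le])
      show "integrable M (\<lambda>x. indicator {x. maxsum T h n x > 0} x * h x)"
        by (rule Bochner_Integration.integrable_bound[OF inth]) (auto simp: indicator_def)
    qed
    finally show ?thesis .
  qed simp
  \<comment> \<open>The events \<open>maxsum T h n x > 0\<close> increase to the event that some
    orbit sum is positive, so dominated convergence carries the bound to the limit.\<close>
  have "(\<lambda>n. \<integral>x. indicator {x. maxsum T h n x > 0} x * h x \<partial>M)
      \<longlonglongrightarrow> (\<integral>x. indicator {x. \<exists>n. (\<Sum>i<n. h ((T ^^ i) x)) > 0} x * h x \<partial>M)"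
  proof (rule integral_dominated_convergence[where w="\<lambda>_. B"])
    have Tn[measurable]: "(T ^^ i) \<in> M \<rightarrow>\<^sub>M M" for i
      by (induction i) (auto simp: id_def[symmetric] intro: measurable_comp)
    show "(\<lambda>x. indicator {x. \<exists>n. (\<Sum>i<n. h ((T ^^ i) x)) > 0} x * h x) \<in> borel_measurable M"
      by measurable
    show "AE x in M. (\<lambda>n. indicator {x. maxsum T h n x > 0} x * h x)
        \<longlonglongrightarrow> indicator {x. \<exists>n. (\<Sum>i<n. h ((T ^^ i) x)) > 0} x * h x"
    proof (rule AE_I2)
      fix x
      show "(\<lambda>n. indicator {x. maxsum T h n x > 0} x * h x)
        \<longlonglongrightarrow> indicator {x. \<exists>n. (\<Sum>i<n. h ((T ^^ i) x)) > 0} x * h x"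
      proof (cases "\<exists>n. (\<Sum>i<n. h ((T ^^ i) x)) > 0")
        case True
        then obtain k where k: "(\<Sum>i<k. h ((T ^^ i) x)) > 0" by blast
        have "maxsum T h n x > 0" if "n \<ge> k" for n
          using sum_le_maxsum[of h T x k] maxsum_mono[OF that, of T h x] k by linarith
        then have "\<forall>\<^sub>F n in sequentially. indicator {x. maxsum T h n x > 0} x * h x
            = indicator {x. \<exists>n. (\<Sum>i<n. h ((T ^^ i) x)) > 0} x * h x"
          using True by (auto simp: eventually_sequentially intro!: exI[of _ k])
        then show ?thesis by (rule tendsto_eventually)
      next
        case False
        have "\<not> maxsum T h n x > 0" for n
          using maxsum_pos_imp[of T h n x] False by metis
        then show ?thesis using False by simp
      qed
    qed
    show "AE x in M. norm (indicator {x. maxsum T h n x > 0} x * h x) \<le> B" for n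
      using bd order_trans[OF abs_ge_zero bd] by (auto simp: indicator_def)
  qed auto
  then show ?thesis by (rule LIMSEQ_le_const) (use fin in blast)
qed

text \<open>Unboundedness of the sums is an invariant event, so by ergodicity it is null or full; the
  maximal inequality excludes the second case.\<close>

lemma ergodic_sums_bdd:
  fixes T :: "'a \<Rightarrow> 'a" and h :: "'a \<Rightarrow> real"
  assumes T[measurable]: "T \<in> M \<rightarrow>\<^sub>M M" and inv: "distr M M T = M"
    and erg: "\<And>A. A \<in> events \<Longrightarrow> T -` A \<inter> space M = A \<Longrightarrow> prob A = 0 \<or> prob A = 1"
    and h[measurable]: "h \<in> borel_measurable M" and bd: "\<And>x. \<bar>h x\<bar> \<le> B"
    and neg: "(\<integral>x. h x \<partial>M) < 0"
  shows "AE x in M. \<exists>K. \<forall>n. (\<Sum>i<n. h ((T ^^ i) x)) \<le> K"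
proof -
  have Tn[measurable]: "(T ^^ i) \<in> M \<rightarrow>\<^sub>M M" for i
    by (induction i) (auto simp: id_def[symmetric] intro: measurable_comp)
  \<comment> \<open>Thresholds range over the naturals to keep the event a countable combination.
    \<open>Z_iff\<close> restores real thresholds, which absorb the shift by \<open>h x\<close> in
    the proof of invariance.\<close>
  define Z where "Z = {x \<in> space M. \<forall>k::nat. \<exists>n. (\<Sum>i<n. h ((T ^^ i) x)) > real k}"
  have Zm[measurable]: "Z \<in> events" unfolding Z_def by measurable
  have Z_iff: "x \<in> Z \<longleftrightarrow> x \<in> space M \<and> (\<forall>K. \<exists>n. (\<Sum>i<n. h ((T ^^ i) x)) > K)" for x
    unfolding Z_def by (auto, meson order_le_less_trans real_arch_simple)
  have "T -` Z \<inter> space M = Z"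
  proof (intro set_eqI iffI)
    fix x assume x: "x \<in> T -` Z \<inter> space M"
    { fix K
      obtain n where "(\<Sum>i<n. h ((T ^^ i) (T x))) > K - h x" using x by (auto simp: Z_iff)
      then have "(\<Sum>i<Suc n. h ((T ^^ i) x)) > K" unfolding sum_funpow_Suc by simp
      then have "\<exists>n. (\<Sum>i<n. h ((T ^^ i) x)) > K" by blast }
    then show "x \<in> Z" using x by (auto simp: Z_iff)
  next
    fix x assume x: "x \<in> Z"
    { fix K
      \<comment> \<open>The \<open>max 0\<close> forces the sum to be nonempty, so that its first
        term can be split off.\<close>
      obtain n where n: "(\<Sum>i<n. h ((T ^^ i) x)) > max 0 (K + h x)" using x unfolding Z_iff by blast
      then have "n \<noteq> 0" by (intro notI) auto
      then obtain m where m: "n = Suc m" by (cases n) auto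
      have "(\<Sum>i<m. h ((T ^^ i) (T x))) > K" using n unfolding m sum_funpow_Suc by auto
      then have "\<exists>n. (\<Sum>i<n. h ((T ^^ i) (T x))) > K" by blast }
    then show "x \<in> T -` Z \<inter> space M" using x measurable_space[OF T] by (auto simp: Z_iff)
  qed
  then have "prob Z = 0 \<or> prob Z = 1" by (intro erg) auto
  moreover have "prob Z \<noteq> 1"
  proof
    assume "prob Z = 1"
    then have "AE x in M. x \<in> Z" using prob_eq_1[OF Zm] by simp
    then have ae: "AE x in M. indicator {x. \<exists>n. (\<Sum>i<n. h ((T ^^ i) x)) > 0} x * h x = h x"
      by eventually_elim (auto simp: Z_iff)
    have "(\<integral>x. indicator {x. \<exists>n. (\<Sum>i<n. h ((T ^^ i) x)) > 0} x * h x \<partial>M) = (\<integral>x. h x \<partial>M)"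
      by (rule integral_cong_AE[OF _ _ ae]) auto
    then show False using maximal_ergodic[OF T inv h bd] neg by simp
  qed
  ultimately have "prob Z = 0" by simp
  then have "AE x in M. x \<notin> Z" using prob_eq_0[OF Zm] by simp
  then have "AE x in M. x \<in> space M \<and> x \<notin> Z" by simp
  then show ?thesis by eventually_elim (auto simp: Z_iff not_less)
qed

text \<open>After subtracting the mean plus a slack \<open>1 / Suc m\<close>, the integrand has
  negative mean, so its orbit sums are almost surely bounded above; the same holds for the reflected
  function. Division by n confines the averages asymptotically to within the slack of the
  mean.\<close>

theorem birkhoff_ergodic_bounded:
  fixes T :: "'a \<Rightarrow> 'a" and f :: "'a \<Rightarrow> real"
  assumes T[measurable]: "T \<in> M \<rightarrow>\<^sub>M M" and inv: "distr M M T = M"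
    and erg: "\<And>A. A \<in> events \<Longrightarrow> T -` A \<inter> space M = A \<Longrightarrow> prob A = 0 \<or> prob A = 1"
    and f[measurable]: "f \<in> borel_measurable M" and bd: "\<And>x. \<bar>f x\<bar> \<le> B"
  shows "AE x in M. (\<lambda>n. (\<Sum>i<n. f ((T ^^ i) x)) / real n) \<longlonglongrightarrow> (\<integral>x. f x \<partial>M)"
proof -
  define \<mu> where "\<mu> = (\<integral>x. f x \<partial>M)"
  have int: "integrable M f" by (rule integrable_const_bound[where B=B]) (use bd in auto)
  have 1: "AE x in M. \<exists>K. \<forall>n. (\<Sum>i<n. f ((T ^^ i) x) - (\<mu> + 1 / Suc m)) \<le> K" for m
  proof (rule ergodic_sums_bdd[OF T inv erg, of "\<lambda>x. f x - (\<mu> + 1 / Suc m)" "B + \<bar>\<mu> + 1 / Suc m\<bar>"])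
    fix x show "\<bar>f x - (\<mu> + 1 / Suc m)\<bar> \<le> B + \<bar>\<mu> + 1 / Suc m\<bar>" using bd[of x] by linarith
  next
    show "(\<integral>x. f x - (\<mu> + 1 / Suc m) \<partial>M) < 0"
      using int by (simp add: \<mu>_def[symmetric] prob_space)
  qed auto
  have 2: "AE x in M. \<exists>K. \<forall>n. (\<Sum>i<n. (\<mu> - 1 / Suc m) - f ((T ^^ i) x)) \<le> K" for m
  proof (rule ergodic_sums_bdd[OF T inv erg, of "\<lambda>x. (\<mu> - 1 / Suc m) - f x" "B + \<bar>\<mu> - 1 / Suc m\<bar>"])
    fix x show "\<bar>(\<mu> - 1 / Suc m) - f x\<bar> \<le> B + \<bar>\<mu> - 1 / Suc m\<bar>" using bd[of x] by linarith
  next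
    show "(\<integral>x. (\<mu> - 1 / Suc m) - f x \<partial>M) < 0"
      using int by (simp add: \<mu>_def[symmetric] prob_space)
  qed auto
  have "AE x in M. \<forall>m::nat. (\<exists>K. \<forall>n. (\<Sum>i<n. f ((T ^^ i) x) - (\<mu> + 1 / Suc m)) \<le> K)
      \<and> (\<exists>K. \<forall>n. (\<Sum>i<n. (\<mu> - 1 / Suc m) - f ((T ^^ i) x)) \<le> K)"
    using 1 2 by (simp add: AE_all_countable)
  then show ?thesis unfolding \<mu>_def[symmetric]
  proof eventually_elim
    case (elim x)
    show ?case
    proof (rule LIMSEQ_I)
      fix e :: real assume "e > 0"
      then obtain m :: nat where m: "1 / Suc m < e / 2"
        by (metis half_gt_zero inverse_eq_divide reals_Archimedean)
      obtain K1 where K1: "\<And>n. (\<Sum>i<n. f ((T ^^ i) x) - (\<mu> + 1 / Suc m)) \<le> K1" using elim by blast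
      obtain K2 where K2: "\<And>n. (\<Sum>i<n. (\<mu> - 1 / Suc m) - f ((T ^^ i) x)) \<le> K2" using elim by blast
      define K where "K = max 0 (max K1 K2)"
      \<comment> \<open>Beyond \<open>N\<close> the bounded excess \<open>K\<close> contributes less
        than \<open>e / 2\<close> to the average; the other half of \<open>e\<close> absorbs the
        slack \<open>1 / Suc m\<close>.\<close>
      obtain N :: nat where N: "K / (e / 2) < N" using reals_Archimedean2 by blast
      show "\<exists>N. \<forall>n\<ge>N. norm ((\<Sum>i<n. f ((T ^^ i) x)) / real n - \<mu>) < e"
      proof (intro exI[of _ "Suc N"] allI impI)
        fix n assume n: "n \<ge> Suc N"
        then have n0: "real n > 0" "real N < real n" by auto
        define s where "s = (\<Sum>i<n. f ((T ^^ i) x))"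
        have a: "s - n * (\<mu> + 1 / Suc m) \<le> K" using K1[of n] by (simp add: sum_subtractf s_def K_def)
        have b: "n * (\<mu> - 1 / Suc m) - s \<le> K" using K2[of n] by (simp add: sum_subtractf s_def K_def)
        have "K < e / 2 * n" proof -
          have "K < N * (e / 2)" using N \<open>e > 0\<close> by (simp add: pos_divide_less_eq)
          also have "\<dots> \<le> n * (e / 2)" using n0 \<open>e > 0\<close> by (intro mult_right_mono) auto
          finally show ?thesis by (simp add: mult.commute)
        qed
        moreover have "n * (1 / Suc m) < n * (e / 2)" using m n0 mult_less_cancel_left_pos by blast
        ultimately have "s - n * \<mu> < n * e" "n * \<mu> - s < n * e"
          using a b by (simp_all add: distrib_left right_diff_distrib mult.commute[of "real n" e])
        then have "\<bar>s - n * \<mu>\<bar> < n * e" by linarith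
        moreover have "s / n - \<mu> = (s - n * \<mu>) / n" using n0 by (simp add: field_simps)
        ultimately show "norm ((\<Sum>i<n. f ((T ^^ i) x)) / real n - \<mu>) < e"
          using n0 by (simp add: s_def[symmetric] abs_divide divide_simps mult.commute)
      qed
    qed
  qed
qed

end

section \<open>I.i.d. sequences\<close>

definition shift_seq :: "nat \<Rightarrow> (nat \<Rightarrow> 'a) \<Rightarrow> nat \<Rightarrow> 'a" where
  "shift_seq n x = (\<lambda>i. x (n + i))"

lemma shift_seq_funpow: "(shift_seq 1 ^^ n) x = shift_seq n x"
  by (induction n) (auto simp: shift_seq_def)

lemma shift_comb_seq [simp]: "shift_seq n (comb_seq n x y) = y"
  by (auto simp: shift_seq_def comb_seq_def)

lemma measurable_shift_seq [measurable]:
  "shift_seq n \<in> (\<Pi>\<^sub>M i\<in>UNIV. M) \<rightarrow>\<^sub>M (\<Pi>\<^sub>M i\<in>UNIV. M)"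
  unfolding shift_seq_def by (rule measurable_PiM_single') (auto simp: space_PiM PiE_iff)

lemma measure_distr_Collect:
  assumes f: "f \<in> M \<rightarrow>\<^sub>M N" and P: "Measurable.pred N P"
  shows "measure (distr M N f) {x \<in> space (distr M N f). P x} = measure M {x \<in> space M. P (f x)}"
proof -
  have "f -` {x \<in> space N. P x} \<inter> space M = {x \<in> space M. P (f x)}"
    using measurable_space[OF f] by auto
  then show ?thesis
    using measure_distr[OF f, of "{x \<in> space N. P x}"] P by (simp add: pred_def)
qed

text \<open>Keeping the later entries in place makes this a permutation of all coordinates, so it
  preserves the i.i.d. product measure.\<close>

definition rev_prefix :: "nat \<Rightarrow> (nat \<Rightarrow> 'a) \<Rightarrow> nat \<Rightarrow> 'a" where
  "rev_prefix k x = (\<lambda>i. if i < k then x (k - 1 - i) else x i)"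

context sequence_space
begin

lemma prob_space_component [simp]: "prob_space M"
  by unfold_locales

lemma distr_reindex:
  assumes "inj f"
  shows "distr S S (\<lambda>x i. x (f i)) = S"
  using distr_PiM_reindex[of UNIV "\<lambda>_. M" f UNIV] assms by (simp add: restrict_UNIV)

lemma distr_shift: "distr S S (shift_seq n) = S"
  unfolding shift_seq_def by (rule distr_reindex) (simp add: inj_def)

lemma distr_rev_prefix: "distr S S (rev_prefix k) = S"
proof -
  have *: "rev_prefix k = (\<lambda>(x :: nat \<Rightarrow> 'a) i. x (if i < k then k - 1 - i else i))"
    by (auto simp: rev_prefix_def fun_eq_iff)
  show ?thesis unfolding * by (rule distr_reindex) (auto simp: inj_def split: if_splits)
qed

lemma measurable_rev_prefix [measurable]: "rev_prefix k \<in> S \<rightarrow>\<^sub>M S"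
  unfolding rev_prefix_def by (rule measurable_PiM_single') (auto simp: space_PiM PiE_iff)

lemma indep_vars_coordinates: "P.indep_vars (\<lambda>_. M) (\<lambda>i x. x i) UNIV"
proof (subst P.indep_vars_iff_distr_eq_PiM)
  show "distr S S (\<lambda>x. \<lambda>i\<in>UNIV. x i) = Pi\<^sub>M UNIV (\<lambda>i. distr S M (\<lambda>x. x i))"
    using distr_PiM_component[of "UNIV :: nat set" "\<lambda>_. M"] by (simp add: restrict_UNIV)
qed auto

text \<open>An invariant set is its own preimage under every iterated shift. It therefore depends
  only on the coordinates from n onwards, for every n, and Kolmogorov's 0-1 law applies.\<close>

lemma shift_invariant_0_1:
  assumes A: "A \<in> sets S" and inv: "shift_seq 1 -` A \<inter> space S = A"
  shows "P.prob A = 0 \<or> P.prob A = 1"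
proof -
  define F where "F i = sigma_sets (space S) {(\<lambda>x. x i) -` B \<inter> space S | B. B \<in> sets M}" for i :: nat
  have sp: "F i \<subseteq> Pow (space S)" for i
    unfolding F_def by (intro subsetI PowI sigma_sets_into_sp) auto
  show ?thesis
  proof (rule P.kolmogorov_0_1_law)
    show "sigma_algebra (space S) (F i)" for i
      unfolding F_def by (rule sigma_algebra_sigma_sets) auto
    show "P.indep_sets F UNIV"
      using indep_vars_coordinates unfolding P.indep_vars_def F_def by auto
    show "A \<in> P.tail_events F"
      unfolding P.tail_events_def
    proof (rule InterI, safe)
      fix n :: nat
      \<comment> \<open>\<open>N\<close> carries the sigma-algebra generated by the coordinates from
        \<open>n\<close> onwards; the n-fold shift is measurable already with respect to it.\<close>
      define N where "N = sigma (space S) (\<Union>i\<in>{n..}. F i)"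
      have spN: "space N = space S" unfolding N_def by (rule space_measure_of) (use sp in auto)
      have setsN: "sets N = sigma_sets (space S) (\<Union>i\<in>{n..}. F i)"
        unfolding N_def by (rule sets_measure_of) (use sp in auto)
      have "shift_seq n \<in> N \<rightarrow>\<^sub>M S"
        unfolding shift_seq_def
      proof (rule measurable_PiM_single')
        fix i :: nat
        show "(\<lambda>x. x (n + i)) \<in> N \<rightarrow>\<^sub>M M"
        proof (rule measurableI)
          fix B assume "B \<in> sets M"
          then have "(\<lambda>x. x (n + i)) -` B \<inter> space S \<in> F (n + i)"
            unfolding F_def by (intro sigma_sets.Basic) blast
          then show "(\<lambda>x. x (n + i)) -` B \<inter> space N \<in> sets N"
            unfolding setsN spN by (intro sigma_sets.Basic) auto
        qed (auto simp: spN space_PiM)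
      qed (auto simp: spN space_PiM)
      then have "shift_seq n -` A \<inter> space N \<in> sets N" using A by (rule measurable_sets)
      moreover have "shift_seq n -` A \<inter> space S = A"
      proof (induction n)
        case 0
        then show ?case using sets.sets_into_space[OF A] by (auto simp: shift_seq_def)
      next
        case (Suc n)
        have eq: "shift_seq (Suc n) x = shift_seq n (shift_seq 1 x)" for x :: "nat \<Rightarrow> 'a"
          by (auto simp: shift_seq_def)
        have "shift_seq 1 x \<in> space S" if "x \<in> space S" for x :: "nat \<Rightarrow> 'a"
          using measurable_space[OF measurable_shift_seq that] .
        then have "shift_seq (Suc n) -` A \<inter> space S = shift_seq 1 -` (shift_seq n -` A \<inter> space S) \<inter> space S"
          unfolding eq[abs_def] by auto
        then show ?case using Suc inv by simp
      qed
      ultimately show "A \<in> sigma_sets (space S) (\<Union> (F ` {n..}))"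
        by (simp add: setsN spN)
    qed
  qed
qed

lemma frequency_shift:
  assumes [measurable]: "Measurable.pred S A"
  shows "AE x in S. (\<lambda>n. real (card {i. i \<le> n \<and> A (shift_seq i x)}) / real n) \<longlonglongrightarrow> \<P>(x in S. A x)"
proof -
  have "AE x in S. (\<lambda>n. (\<Sum>i<n. indicator {x\<in>space S. A x} ((shift_seq 1 ^^ i) x)) / real n)
      \<longlonglongrightarrow> (\<integral>x. indicator {x\<in>space S. A x} x \<partial>S)"
    by (rule P.birkhoff_ergodic_bounded[OF measurable_shift_seq distr_shift shift_invariant_0_1, where B=1])
      (auto simp: indicator_def)
  then have "AE x in S. (\<lambda>n. (\<Sum>i<n. indicator {x\<in>space S. A x} (shift_seq i x)) / real n)
      \<longlonglongrightarrow> \<P>(x in S. A x)"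
    by (simp only: shift_seq_funpow) simp
  with AE_space show ?thesis
  proof eventually_elim
    case (elim x)
    have sp: "shift_seq i x \<in> space S" for i
      using elim measurable_space[OF measurable_shift_seq] by blast
    have eq: "(\<Sum>i<n. indicator {x\<in>space S. A x} (shift_seq i x)) = real (card {i. i < n \<and> A (shift_seq i x)})" for n
      using sp by (simp add: indicator_def sum.If_cases) (intro arg_cong[where f=card], auto)
    \<comment> \<open>The count over \<open>i <= n\<close> has n + 1 candidates, whereas the
      normalization is n. The average over \<open>Suc n\<close> terms is therefore multiplied by
      \<open>Suc n / n\<close>, which tends to 1.\<close>
    have "(\<lambda>n. real (card {i. i < Suc n \<and> A (shift_seq i x)}) / real (Suc n)) \<longlonglongrightarrow> \<P>(x in S. A x)"
      using elim unfolding eq by (intro LIMSEQ_Suc) auto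
    moreover have "(\<lambda>n. real (Suc n) / real n) \<longlonglongrightarrow> 1"
      by (rule LIMSEQ_Suc_n_over_n)
    ultimately have "(\<lambda>n. real (card {i. i < Suc n \<and> A (shift_seq i x)}) / real (Suc n) * (real (Suc n) / real n))
      \<longlonglongrightarrow> \<P>(x in S. A x) * 1"
      by (rule tendsto_mult)
    then show ?case by (simp add: less_Suc_eq_le del: of_nat_Suc)
  qed
qed

text \<open>The first \<open>k\<close> entries and the remaining ones may be drawn from two
  independent sequences, and reversing a prefix of the first one does not change its law. This
  presents the past of time \<open>k\<close>, read backwards, and its future as independent
  walks.\<close>

lemma prob_split:
  assumes [measurable]: "Measurable.pred S A"
  shows "\<P>(x in S. A x) = \<P>(z in S \<Otimes>\<^sub>M S. A (comb_seq k (rev_prefix k (fst z)) (snd z)))"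
proof -
  have "sigma_finite_measure (distr S S (\<lambda>y. y))" by (simp add: P.sigma_finite_measure_axioms)
  then have "distr S S (rev_prefix k) \<Otimes>\<^sub>M distr S S (\<lambda>y. y)
      = distr (S \<Otimes>\<^sub>M S) (S \<Otimes>\<^sub>M S) (\<lambda>(x, y). (rev_prefix k x, y))"
    by (intro pair_measure_distr) auto
  then have 1: "distr (S \<Otimes>\<^sub>M S) (S \<Otimes>\<^sub>M S) (\<lambda>(x, y). (rev_prefix k x, y)) = S \<Otimes>\<^sub>M S"
    by (simp add: distr_rev_prefix)
  have "\<P>(x in S. A x) = \<P>(x in distr (S \<Otimes>\<^sub>M S) S (\<lambda>(x, y). comb_seq k x y). A x)"
    unfolding PiM_comb_seq ..
  also have "\<dots> = \<P>(z in S \<Otimes>\<^sub>M S. A (comb_seq k (fst z) (snd z)))"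
    by (subst measure_distr_Collect) (auto simp: case_prod_beta measurable_comb_seq assms)
  also have "\<dots> = \<P>(z in distr (S \<Otimes>\<^sub>M S) (S \<Otimes>\<^sub>M S) (\<lambda>(x, y). (rev_prefix k x, y)). A (comb_seq k (fst z) (snd z)))"
    unfolding 1 ..
  also have "\<dots> = \<P>(z in S \<Otimes>\<^sub>M S. A (comb_seq k (rev_prefix k (fst z)) (snd z)))"
    by (subst measure_distr_Collect) (simp_all add: case_prod_beta)
  finally show ?thesis .
qed

end

section \<open>Counting boundary points along a path\<close>

lemma embed_diff: "embed (a - b) = embed a - embed b"
  by (simp add: embed_def vec_eq_iff)

lemma mem_nbhd_iff: "z \<in> nbhd (a :: int ^ 'd) \<longleftrightarrow> z - a \<in> nbhd 0"
proof -
  have "embed (0 :: int ^ 'd) = 0" by (simp add: embed_def vec_eq_iff)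
  then show ?thesis by (simp add: nbhd_def dist_norm embed_diff norm_minus_commute)
qed

text \<open>Makes coverage of a neighbourhood readable from a path recentred at any site
  \<open>c\<close>, hence from shifted increments alone.\<close>

lemma nbhd_subset_translate: "nbhd (a - c) \<subseteq> (\<lambda>m. s m - c) ` A \<longleftrightarrow> nbhd a \<subseteq> s ` A"
proof
  assume *: "nbhd (a - c) \<subseteq> (\<lambda>m. s m - c) ` A"
  show "nbhd a \<subseteq> s ` A"
  proof
    fix z assume "z \<in> nbhd a"
    then have "z - c \<in> nbhd (a - c)" by (simp add: mem_nbhd_iff[of z a] mem_nbhd_iff[of "z - c"])
    then show "z \<in> s ` A" using * by auto
  qed
next
  assume *: "nbhd a \<subseteq> s ` A"
  show "nbhd (a - c) \<subseteq> (\<lambda>m. s m - c) ` A"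
  proof
    fix z assume "z \<in> nbhd (a - c)"
    moreover have "z - (a - c) = z + c - a" by simp
    ultimately have "z + c \<in> nbhd a" using mem_nbhd_iff by metis
    then obtain m where "m \<in> A" "z + c = s m" using * by auto
    then show "z \<in> (\<lambda>m. s m - c) ` A" by (intro image_eqI[of _ _ m]) (auto simp: algebra_simps)
  qed
qed

text \<open>Each coordinate of a neighbour differs by at most 1 from that of the centre, so all
  neighbours lie in a finite box.\<close>

lemma finite_nbhd: "finite (nbhd (a :: int ^ 'd))"
proof -
  have "nbhd a \<subseteq> vec_lambda ` (PiE UNIV (\<lambda>i. {a $ i - 1..a $ i + 1}))"
  proof
    fix z assume "z \<in> nbhd a"
    then have d: "norm (embed a - embed z) = 1" by (simp add: nbhd_def dist_norm)
    have "\<bar>a $ i - z $ i\<bar> \<le> 1" for i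
    proof -
      have "\<bar>(embed a - embed z) $ i\<bar> \<le> 1" using component_le_norm_cart[of "embed a - embed z" i] d by simp
      then show ?thesis by (simp add: embed_def)
    qed
    then have "(\<lambda>i. z $ i) \<in> PiE UNIV (\<lambda>i. {a $ i - 1..a $ i + 1})" by (auto simp: abs_le_iff algebra_simps)
    then show "z \<in> vec_lambda ` (PiE UNIV (\<lambda>i. {a $ i - 1..a $ i + 1}))"
      by (rule image_eqI[rotated]) simp
  qed
  then show ?thesis by (rule finite_subset) (intro finite_imageI finite_PiE, auto)
qed

section \<open>Representation of boundary sites by times\<close>

definition path_from :: "nat \<Rightarrow> (nat \<Rightarrow> int ^ 'd) \<Rightarrow> nat \<Rightarrow> int ^ 'd" where
  "path_from i s = (\<lambda>m. s (i + m) - s i)"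

text \<open>Finiteness is demanded separately because \<open>card\<close> of an infinite set is 0;
  otherwise a path with infinitely many returns would pass for one with none.\<close>

definition returns :: "nat \<Rightarrow> (nat \<Rightarrow> int ^ 'd) \<Rightarrow> bool" where
  "returns q s \<longleftrightarrow> finite {m. 0 < m \<and> s m = 0} \<and> card {m. 0 < m \<and> s m = 0} = q"

lemma path_from_path_from: "path_from i (path_from j s) = path_from (j + i) s"
  by (auto simp: path_from_def add.assoc)

lemma returns_path_from:
  "returns q (path_from i s) \<longleftrightarrow> finite {m. i < m \<and> s m = s i} \<and> card {m. i < m \<and> s m = s i} = q"
proof -
  have eq: "{m. i < m \<and> s m = s i} = (+) i ` {m. 0 < m \<and> path_from i s m = 0}"
  proof (intro set_eqI iffI)
    fix m assume "m \<in> {m. i < m \<and> s m = s i}"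
    then show "m \<in> (+) i ` {m. 0 < m \<and> path_from i s m = 0}"
      by (intro image_eqI[of _ _ "m - i"]) (auto simp: path_from_def)
  qed (auto simp: path_from_def)
  show ?thesis unfolding returns_def eq by (simp add: finite_image_iff card_image)
qed

text \<open>A site with at least \<open>q + 1\<close> visits is represented by its \<open>(q + 1)\<close>-st visit counted from the end;
  with the flag \<open>b\<close> this visit is also required to be the first one, so that there are exactly
  \<open>q + 1\<close> visits.\<close>

definition last_visits :: "bool \<Rightarrow> nat \<Rightarrow> (nat \<Rightarrow> int ^ 'd) \<Rightarrow> nat \<Rightarrow> nat set" where
  "last_visits b q s n = {i. i \<le> n \<and> card {m. i < m \<and> m \<le> n \<and> s m = s i} = q
     \<and> \<not> nbhd (s i) \<subseteq> s ` {0..n} \<and> (b \<longrightarrow> s i \<notin> s ` {..<i})}"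

lemma last_visitsD:
  assumes "i \<in> last_visits b q s n"
  shows "i \<le> n" "card {m. i < m \<and> m \<le> n \<and> s m = s i} = q" "\<not> nbhd (s i) \<subseteq> s ` {0..n}"
    "b \<Longrightarrow> s i \<notin> s ` {..<i}"
  using assms by (simp_all add: last_visits_def)

text \<open>If i < j had the same site, the later visits of i would contain j and all later visits
  of j, so the two numbers could not both be \<open>q\<close>. The set \<open>T\<close> is the
  finite horizon for \<open>last_visits\<close> and all of time for \<open>returns\<close>.\<close>

lemma inj_on_card_later:
  assumes "\<And>i. i \<in> A \<Longrightarrow> i \<in> T \<and> finite {m \<in> T. i < m \<and> s m = s i} \<and> card {m \<in> T. i < m \<and> s m = s i} = q"
  shows "inj_on s (A :: nat set)"
proof (rule linorder_inj_onI)
  fix i j assume ij: "i < j" "i \<in> A" "j \<in> A"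
  show "s i \<noteq> s j"
  proof
    assume eq: "s i = s j"
    then have "insert j {m \<in> T. j < m \<and> s m = s j} \<subseteq> {m \<in> T. i < m \<and> s m = s i}"
      using ij(1) conjunct1[OF assms[OF ij(3)]] by auto
    then have "card (insert j {m \<in> T. j < m \<and> s m = s j}) \<le> card {m \<in> T. i < m \<and> s m = s i}"
      using conjunct1[OF conjunct2[OF assms[OF ij(2)]]] by (intro card_mono)
    then show False using assms[OF ij(2)] assms[OF ij(3)] by simp
  qed
qed auto

lemma inj_on_last_visits: "inj_on s (last_visits b q s n)"
proof (rule inj_on_card_later[where T="{..n}" and q=q])
  fix i assume "i \<in> last_visits b q s n"
  moreover have "{m \<in> {..n}. i < m \<and> s m = s i} = {m. i < m \<and> m \<le> n \<and> s m = s i}" by auto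
  ultimately show "i \<in> {..n} \<and> finite {m \<in> {..n}. i < m \<and> s m = s i} \<and> card {m \<in> {..n}. i < m \<and> s m = s i} = q"
    by (simp add: last_visits_def)
qed

lemma inj_on_returns: "inj_on s {i. returns q (path_from i s)}"
  by (rule inj_on_card_later[where T=UNIV and q=q]) (auto simp: returns_path_from)

text \<open>For \<open>q = 0\<close> the maximum serves. For the successor the maximum is deleted
  first: an element with q larger ones among the rest has one more in the whole set.\<close>

lemma ex_card_greater_eq:
  fixes V :: "nat set"
  assumes "finite V" "card V \<ge> Suc q"
  shows "\<exists>i\<in>V. card {m \<in> V. i < m} = q"
  using assms
proof (induction q arbitrary: V)
  case 0
  then have "V \<noteq> {}" by auto
  then have "Max V \<in> V" "{m \<in> V. Max V < m} = {}" using 0 by (auto simp: not_less)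
  moreover have "card ({} :: nat set) = 0" by simp
  ultimately show ?case by (intro bexI[of _ "Max V"]) (simp_all only:)
next
  case (Suc q)
  have "V \<noteq> {}" using Suc.prems(2) by auto
  then have M: "Max V \<in> V" using Suc.prems(1) by simp
  have "card (V - {Max V}) \<ge> Suc q" using Suc.prems M by simp
  then have "\<exists>i\<in>V - {Max V}. card {m \<in> V - {Max V}. i < m} = q"
    using Suc.prems(1) by (intro Suc.IH) auto
  then obtain i where i: "i \<in> V - {Max V}" "card {m \<in> V - {Max V}. i < m} = q" by blast
  have "i \<le> Max V" using i Suc.prems(1) by (intro Max_ge) auto
  then have "i < Max V" using i by auto
  then have "{m \<in> V. i < m} = insert (Max V) {m \<in> V - {Max V}. i < m}" using M by blast
  then have "card {m \<in> V. i < m} = Suc q" using i(2) Suc.prems(1) by simp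
  then show ?case using i(1) by blast
qed

lemma visits_split:
  assumes "i \<le> n"
  shows "visits s n (s i) = Suc (card {m. m < i \<and> s m = s i} + card {m. i < m \<and> m \<le> n \<and> s m = s i})"
proof -
  have "{m. m \<le> n \<and> s m = s i} = insert i ({m. m < i \<and> s m = s i} \<union> {m. i < m \<and> m \<le> n \<and> s m = s i})"
    using assms by auto
  moreover have "card ({m. m < i \<and> s m = s i} \<union> {m. i < m \<and> m \<le> n \<and> s m = s i})
      = card {m. m < i \<and> s m = s i} + card {m. i < m \<and> m \<le> n \<and> s m = s i}"
    by (rule card_Un_disjoint) auto
  moreover have "finite ({m. m < i \<and> s m = s i} \<union> {m. i < m \<and> m \<le> n \<and> s m = s i})" by auto
  ultimately show ?thesis unfolding visits_def by simp
qed

text \<open>The map from times to sites is injective on \<open>last_visits\<close>, since the number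
  of later visits is fixed, and it reaches every counted site by \<open>ex_card_greater_eq\<close>.
  The representing visit itself accounts for the step from \<open>q\<close> to
  \<open>Suc q\<close>.\<close>

lemma J_eq_card_last_visits:
  "(if b then J_exactly (Suc q) s n else J_atleast (Suc q) s n) = card (last_visits b q s n)"
proof -
  let ?X = "{x \<in> inner_boundary s n. if b then visits s n x = Suc q else visits s n x \<ge> Suc q}"
  have "s ` last_visits b q s n = ?X"
  proof (intro set_eqI iffI)
    fix x assume "x \<in> s ` last_visits b q s n"
    then obtain i where i: "i \<in> last_visits b q s n" "x = s i" by auto
    then have "visits s n x = Suc (card {m. m < i \<and> s m = s i} + q)"
      using visits_split[of i n s] by (simp add: last_visits_def)
    moreover have "card {m. m < i \<and> s m = s i} = 0" if b
    proof -
      have "{m. m < i \<and> s m = s i} = {}" using last_visitsD(4)[OF i(1) that] by (auto simp: image_iff dest: sym)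
      then show ?thesis by (simp only: card.empty)
    qed
    ultimately have "if b then visits s n x = Suc q else visits s n x \<ge> Suc q" by auto
    moreover have "x \<in> inner_boundary s n"
      using last_visitsD(1,3)[OF i(1)] i(2) by (auto simp: inner_boundary_def)
    ultimately show "x \<in> ?X" by simp
  next
    fix x assume x: "x \<in> ?X"
    define V where "V = {m. m \<le> n \<and> s m = x}"
    have "finite V" "card V \<ge> Suc q" using x by (auto simp: V_def visits_def split: if_splits)
    then obtain i where i: "i \<in> V" "card {m \<in> V. i < m} = q" using ex_card_greater_eq by blast
    have eq: "{m \<in> V. i < m} = {m. i < m \<and> m \<le> n \<and> s m = s i}" using i by (auto simp: V_def)
    have vis: "visits s n x = Suc (card {m. m < i \<and> s m = s i} + q)"
      using i visits_split[of i n s] unfolding eq by (auto simp: V_def)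
    have "s i \<notin> s ` {..<i}" if b
    proof -
      have "card {m. m < i \<and> s m = s i} = 0" using vis x that by simp
      then have "{m. m < i \<and> s m = s i} = {}" by simp
      then show ?thesis by force
    qed
    moreover have "\<not> nbhd (s i) \<subseteq> s ` {0..n}" using x i by (auto simp: inner_boundary_def V_def)
    ultimately have "i \<in> last_visits b q s n" using i unfolding eq by (auto simp: last_visits_def V_def)
    then show "x \<in> s ` last_visits b q s n" using i by (auto simp: V_def)
  qed
  then have "card (last_visits b q s n) = card ?X" using card_image[OF inj_on_last_visits, of s b q n] by simp
  then show ?thesis by (cases b) (simp_all add: J_exactly_def J_atleast_def)
qed

text \<open>The time \<open>k\<close> plays the role of the present: only \<open>k\<close> steps of the past are inspected. The last
  two events below bound the times at which this truncation gives the wrong answer.\<close>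

definition upper_event :: "bool \<Rightarrow> nat \<Rightarrow> nat \<Rightarrow> (nat \<Rightarrow> int ^ 'd) \<Rightarrow> bool" where
  "upper_event b q k s \<longleftrightarrow> returns q (path_from k s) \<and> \<not> nbhd (s k) \<subseteq> s ` {0..2 * k}
     \<and> (b \<longrightarrow> s k \<notin> s ` {..<k})"

text \<open>Here the whole future is inspected, and the returns must occur within \<open>k\<close>
  steps of the present time \<open>k\<close>. A horizon at least \<open>2 * k\<close> after the
  start of the path then sees all returns, and only visits made before that start can spoil the
  count.\<close>

definition lower_event :: "bool \<Rightarrow> nat \<Rightarrow> nat \<Rightarrow> (nat \<Rightarrow> int ^ 'd) \<Rightarrow> bool" where
  "lower_event b q k s \<longleftrightarrow> returns q (path_from k s) \<and> (\<forall>m>2 * k. s m \<noteq> s k)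
     \<and> \<not> nbhd (s k) \<subseteq> range s \<and> (b \<longrightarrow> s k \<notin> s ` {..<k})"

definition late_return :: "nat \<Rightarrow> (nat \<Rightarrow> int ^ 'd) \<Rightarrow> bool" where
  "late_return k s \<longleftrightarrow> (\<forall>m. 0 < m \<and> m \<le> k \<longrightarrow> s m \<noteq> 0) \<and> (\<exists>m>k. s m = 0)"

text \<open>The sign: if an earlier time sits at \<open>s i + z\<close>, then the site
  \<open>s i\<close> has displacement \<open>- z\<close> as seen from it. Finiteness of the visits
  is what makes the event disappear as \<open>k\<close> grows, even for a recurrent walk.\<close>

definition late_visit :: "nat \<Rightarrow> (nat \<Rightarrow> int ^ 'd) \<Rightarrow> bool" where
  "late_visit k s \<longleftrightarrow> (\<exists>z\<in>insert 0 (nbhd 0). (\<exists>m>k. s m = - z) \<and> finite {m. s m = - z})"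

lemma image_path_from_shift: "path_from j s ` A = (\<lambda>x. x - s j) ` s ` ((+) j ` A)"
  by (auto simp: path_from_def image_image)

lemma card_near_end: "card {i. i \<le> n \<and> n < i + k} \<le> (k :: nat)"
proof -
  have "{i. i \<le> n \<and> n < i + k} \<subseteq> (\<lambda>m. n - m) ` {..<k}"
  proof
    fix i assume "i \<in> {i. i \<le> n \<and> n < i + k}"
    then show "i \<in> (\<lambda>m. n - m) ` {..<k}" by (intro image_eqI[of _ _ "n - i"]) auto
  qed
  then have "card {i. i \<le> n \<and> n < i + k} \<le> card ((\<lambda>m. n - m) ` {..<k})" by (intro card_mono) auto
  also have "\<dots> \<le> k" using card_image_le[of "{..<k}" "\<lambda>m. n - m"] by simp
  finally show ?thesis .
qed

text \<open>A counted time at distance at least \<open>k\<close> from both ends whose infinite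
  future has exactly \<open>q\<close> returns yields an upper event \<open>k\<close> steps earlier.
  The other counted times away from the ends have a site that is revisited after \<open>n\<close>,
  and they are charged to late returns.\<close>

lemma card_last_visits_le:
  "card (last_visits b q s n) \<le> card {i. i \<le> n \<and> upper_event b q k (path_from i s)}
     + card {j. j \<le> n \<and> late_return k (path_from j s)} + 3 * k"
proof -
  let ?L = "last_visits b q s n"
  let ?U = "{i. i \<le> n \<and> upper_event b q k (path_from i s)}"
  let ?H = "{j. j \<le> n \<and> late_return k (path_from j s)}"
  let ?E = "{i. i \<le> n \<and> n < i + k}"
  define B where "B = {i \<in> ?L. \<not> returns q (path_from i s)}"
  have finL: "finite ?L" by (simp add: last_visits_def)
  have "?L \<subseteq> {..<k} \<union> ?E \<union> (\<lambda>j. j + k) ` ?U \<union> B"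
  proof
    fix i assume i: "i \<in> ?L"
    show "i \<in> {..<k} \<union> ?E \<union> (\<lambda>j. j + k) ` ?U \<union> B"
    proof (cases "k \<le> i \<and> i + k \<le> n \<and> returns q (path_from i s)")
      case True
      define j where "j = i - k"
      have ij: "i = j + k" using True by (simp add: j_def)
      have sub: "s ` {j..j + 2 * k} \<subseteq> s ` {0..n}" using True ij by (intro image_mono) auto
      have "path_from j s ` {0..2 * k} = (\<lambda>m. s m - s j) ` {j..j + 2 * k}"
        unfolding image_path_from_shift by (simp add: image_image add.commute)
      moreover have "path_from j s k = s i - s j" by (simp add: path_from_def ij)
      ultimately have "\<not> nbhd (path_from j s k) \<subseteq> path_from j s ` {0..2 * k}"
        using i sub nbhd_subset_translate[of "s i" "s j" s "{j..j + 2 * k}"]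
        last_visitsD(3)[OF i] by (metis order_trans)
      moreover have "path_from j s k \<notin> path_from j s ` {..<k}" if b
        using last_visitsD(4)[OF i that] ij by (auto simp: path_from_def)
      ultimately have "upper_event b q k (path_from j s)"
        using True by (auto simp: upper_event_def path_from_path_from ij)
      moreover have "j \<le> n" using True ij by simp
      ultimately show ?thesis by (auto simp: ij)
    qed (use i in \<open>auto simp: B_def last_visits_def\<close>)
  qed
  then have "card ?L \<le> card ({..<k} \<union> ?E \<union> (\<lambda>j. j + k) ` ?U \<union> B)"
    using finL by (intro card_mono) (auto simp: B_def)
  also have "\<dots> \<le> card {..<k} + card ?E + card ((\<lambda>j. j + k) ` ?U) + card B"
    by (meson card_Un_le add_mono le_refl order_trans)
  also have "card ((\<lambda>j. j + k) ` ?U) = card ?U" by (intro card_image) simp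
  finally have 1: "card ?L \<le> k + card ?E + card ?U + card B" by simp
  \<comment> \<open>A site in question is charged to its last visit \<open>j\<close> up to time
    \<open>n\<close>: its next visit comes after \<open>n\<close>, hence after more than
    \<open>k\<close> steps unless \<open>j\<close> is near the end. Counting sites suffices because
    distinct elements of \<open>B\<close> have distinct sites.\<close>
  have "s ` B \<subseteq> s ` (?E \<union> ?H)"
  proof
    fix x assume "x \<in> s ` B"
    then obtain i where i: "i \<in> B" "x = s i" by auto
    define V where "V = {m. m \<le> n \<and> s m = x}"
    have "i \<in> V" "finite V" using i by (auto simp: V_def B_def last_visits_def)
    define j where "j = Max V"
    have j: "j \<in> V" unfolding j_def using \<open>i \<in> V\<close> \<open>finite V\<close> by (intro Max_in) auto
    have maxj: "m \<le> j" if "m \<in> V" for m unfolding j_def using that \<open>finite V\<close> by simp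
    have "\<exists>m>n. s m = s i"
    proof (rule ccontr)
      assume "\<not> ?thesis"
      then have "{m. i < m \<and> s m = s i} = {m. i < m \<and> m \<le> n \<and> s m = s i}" by (auto simp: not_less)
      then have "returns q (path_from i s)"
        using i by (auto simp: returns_path_from B_def last_visits_def)
      then show False using i by (simp add: B_def)
    qed
    then obtain m where m: "m > n" "s m = s i" by blast
    have "late_return k (path_from j s)" if "j + k \<le> n"
      unfolding late_return_def
    proof
      show "\<forall>m. 0 < m \<and> m \<le> k \<longrightarrow> path_from j s m \<noteq> 0"
      proof (intro allI impI notI)
        fix m assume "0 < m \<and> m \<le> k" "path_from j s m = 0"
        then have "j + m \<in> V" using j that by (auto simp: V_def path_from_def)
        then show False using maxj \<open>0 < m \<and> m \<le> k\<close> by fastforce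
      qed
      show "\<exists>m>k. path_from j s m = 0"
        using m that j i by (intro exI[of _ "m - j"]) (auto simp: path_from_def V_def)
    qed
    moreover have "j \<le> n" using j by (simp add: V_def)
    ultimately have "j \<in> ?E \<union> ?H" by (cases "j + k \<le> n") auto
    then show "x \<in> s ` (?E \<union> ?H)" using j by (auto simp: V_def)
  qed
  then have "card (s ` B) \<le> card (s ` (?E \<union> ?H))" by (intro card_mono) auto
  also have "\<dots> \<le> card (?E \<union> ?H)" by (rule card_image_le) auto
  also have "\<dots> \<le> card ?E + card ?H" by (rule card_Un_le)
  also have "card (s ` B) = card B"
    by (rule card_image, rule inj_on_subset[OF inj_on_last_visits]) (auto simp: B_def)
  finally have "card B \<le> card ?E + card ?H" .
  then show ?thesis using 1 card_near_end[of n k] by simp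
qed

text \<open>A lower event at j makes \<open>j + k\<close> a counted time unless the horizon is too
  close or the site of \<open>j + k\<close> or one of its neighbours was visited before j. The
  latter exceptions are charged to those earlier visits.\<close>

lemma card_lower_event_le:
  "card {i. i \<le> n \<and> lower_event b q k (path_from i s)} \<le> card (last_visits b q s n)
     + card (insert 0 (nbhd (0 :: int ^ 'd))) * card {j. j \<le> n \<and> late_visit k (path_from j (s :: nat \<Rightarrow> int ^ 'd))} + 2 * k"
proof -
  let ?N = "insert 0 (nbhd (0 :: int ^ 'd))"
  let ?L = "last_visits b q s n"
  let ?W = "{i. i \<le> n \<and> lower_event b q k (path_from i s)}"
  let ?G = "{j. j \<le> n \<and> late_visit k (path_from j s)}"
  \<comment> \<open>With \<open>i = j + k\<close>, the times below \<open>i - k\<close> are exactly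
    those before the start \<open>j\<close> of the inspected window.\<close>
  define E where "E = {i. i \<le> n \<and> returns q (path_from i s) \<and> (\<exists>z\<in>?N. s i + z \<in> s ` {..<i - k})}"
  have finL: "finite ?L" by (simp add: last_visits_def)
  have sub: "(\<lambda>j. j + k) ` {j \<in> ?W. j + 2 * k \<le> n} \<subseteq> ?L \<union> E"
  proof
    fix i assume "i \<in> (\<lambda>j. j + k) ` {j \<in> ?W. j + 2 * k \<le> n}"
    then obtain j where j: "i = j + k" "j + 2 * k \<le> n" "lower_event b q k (path_from j s)" by auto
    have ret: "returns q (path_from i s)"
      using j by (simp add: lower_event_def path_from_path_from)
    show "i \<in> ?L \<union> E"
    proof (cases "\<exists>z\<in>?N. s i + z \<in> s ` {..<j}")
      case True
      then show ?thesis using ret j by (auto simp: E_def)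
    next
      case False
      have late: "s m \<noteq> s i" if "m > j + 2 * k" for m
      proof -
        have "m - j > 2 * k" "j + (m - j) = m" using that by auto
        moreover have "path_from j s (m - j) \<noteq> path_from j s k"
          using j(3) \<open>m - j > 2 * k\<close> unfolding lower_event_def by blast
        ultimately show ?thesis by (simp add: path_from_def j(1))
      qed
      have "{m. i < m \<and> s m = s i} = {m. i < m \<and> m \<le> n \<and> s m = s i}"
      proof -
        have "m \<le> n" if "s m = s i" for m using late[of m] that j(2) by (meson le_trans not_le)
        then show ?thesis by auto
      qed
      then have "card {m. i < m \<and> m \<le> n \<and> s m = s i} = q" using ret by (simp add: returns_path_from)
      moreover have "\<not> nbhd (s i) \<subseteq> s ` {0..n}"
      proof -
        have "path_from j s k = s i - s j" by (simp add: path_from_def j)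
        moreover have "range (path_from j s) = (\<lambda>m. s m - s j) ` {j..}"
        proof -
          have "range ((+) j) = {j..}" by (auto simp: image_iff le_iff_add)
          then show ?thesis unfolding image_path_from_shift by (simp add: image_image)
        qed
        ultimately have "\<not> nbhd (s i) \<subseteq> s ` {j..}"
          using j(3) nbhd_subset_translate[of "s i" "s j" s "{j..}"] by (auto simp: lower_event_def)
        then obtain y where y: "y \<in> nbhd (s i)" "y \<notin> s ` {j..}" by blast
        have "y - s i \<in> ?N" using y mem_nbhd_iff by blast
        then have "s i + (y - s i) \<notin> s ` {..<j}" using False by blast
        then have "y \<notin> s ` {..<j}" by simp
        moreover have "{0..n} \<subseteq> {..<j} \<union> {j..}" by auto
        ultimately have "y \<notin> s ` {0..n}" using y by blast
        then show ?thesis using y by blast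
      qed
      moreover have "s i \<notin> s ` {..<i}" if b
      proof -
        have "path_from j s k \<notin> path_from j s ` {..<k}" using j(3) that by (simp add: lower_event_def)
        then have 1: "s i \<noteq> s (j + m)" if "m < k" for m
          using that j(1) by (auto simp: path_from_def)
        have 2: "s i \<notin> s ` {..<j}" using False by auto
        show ?thesis
        proof
          assume "s i \<in> s ` {..<i}"
          then obtain m where m: "m < i" "s i = s m" by auto
          then have "j \<le> m" using 2 by (metis imageI lessThan_iff not_le)
          then show False using 1[of "m - j"] m j(1) by simp
        qed
      qed
      ultimately show ?thesis using j by (auto simp: last_visits_def)
    qed
  qed
  have "?W \<subseteq> {j \<in> ?W. j + 2 * k \<le> n} \<union> {j. j \<le> n \<and> n < j + 2 * k}" by auto
  then have "card ?W \<le> card ({j \<in> ?W. j + 2 * k \<le> n} \<union> {j. j \<le> n \<and> n < j + 2 * k})"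
    by (intro card_mono) auto
  also have "\<dots> \<le> card {j \<in> ?W. j + 2 * k \<le> n} + card {j. j \<le> n \<and> n < j + 2 * k}" by (rule card_Un_le)
  also have "card {j. j \<le> n \<and> n < j + 2 * k} \<le> 2 * k" by (rule card_near_end)
  also have "card {j \<in> ?W. j + 2 * k \<le> n} = card ((\<lambda>j. j + k) ` {j \<in> ?W. j + 2 * k \<le> n})"
    by (intro card_image[symmetric]) simp
  also have "\<dots> \<le> card (?L \<union> E)" using sub finL by (intro card_mono) (auto simp: E_def)
  also have "\<dots> \<le> card ?L + card E" by (rule card_Un_le)
  finally have 1: "card ?W \<le> card ?L + card E + 2 * k" by simp
  \<comment> \<open>An earlier visit \<open>j\<close> to \<open>s i + z\<close> determines the site
    \<open>s i\<close> once \<open>z\<close> is given, so each \<open>j\<close> is charged at most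
    once per element of \<open>?N\<close>. Times in \<open>E\<close> have distinct sites since each
    has exactly \<open>q\<close> later returns.\<close>
  have "s ` E \<subseteq> (\<Union>z\<in>?N. (\<lambda>j. s j - z) ` ?G)"
  proof
    fix x assume "x \<in> s ` E"
    then obtain i z j where *: "x = s i" "i \<le> n" "returns q (path_from i s)" "z \<in> ?N"
      "j < i - k" "s i + z = s j" unfolding E_def by blast
    have "path_from j s (i - j) = - z" using *(5,6) by (simp add: path_from_def algebra_simps)
    moreover have "i - j > k" using *(5) by simp
    \<comment> \<open>All visits to the site of \<open>i\<close> occur up to time \<open>i\<close>
      or among its finitely many later returns.\<close>
    moreover have "finite {m. path_from j s m = - z}"
    proof -
      have eq: "s i = s j - z" using *(6) by (simp add: eq_diff_eq)
      have "(+) j ` {m. path_from j s m = - z} \<subseteq> {..i} \<union> {m. i < m \<and> s m = s i}"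
      proof
        fix l assume "l \<in> (+) j ` {m. path_from j s m = - z}"
        then obtain m where "l = j + m" "s (j + m) - s j = - z" by (auto simp: path_from_def)
        then have "s l = s i" unfolding eq by (simp add: diff_eq_eq)
        then show "l \<in> {..i} \<union> {m. i < m \<and> s m = s i}" by auto
      qed
      then have "finite ((+) j ` {m. path_from j s m = - z})"
        using *(3) by (auto simp: returns_path_from intro: finite_subset)
      then show ?thesis by (simp add: finite_image_iff)
    qed
    ultimately have "late_visit k (path_from j s)" using *(4) unfolding late_visit_def by blast
    moreover have "j \<le> n" using * by simp
    moreover have "x = s j - z" using * by (simp add: algebra_simps)
    ultimately show "x \<in> (\<Union>z\<in>?N. (\<lambda>j. s j - z) ` ?G)" using *(4) by blast
  qed
  then have "card (s ` E) \<le> card (\<Union>z\<in>?N. (\<lambda>j. s j - z) ` ?G)"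
    by (intro card_mono finite_UN_I finite.insertI finite_nbhd finite_imageI) auto
  also have "\<dots> \<le> (\<Sum>z\<in>?N. card ((\<lambda>j. s j - z) ` ?G))"
    using finite_nbhd by (intro card_UN_le) auto
  also have "\<dots> \<le> (\<Sum>z\<in>?N. card ?G)" by (intro sum_mono card_image_le) auto
  also have "card (s ` E) = card E"
    by (rule card_image, rule inj_on_subset[OF inj_on_returns[of s q]]) (auto simp: E_def)
  finally have "card E \<le> card ?N * card ?G" by simp
  then show ?thesis using 1 by linarith
qed

section \<open>Measurability and truncation limits\<close>

lemma measurable_count_space_binop:
  fixes f :: "'a \<Rightarrow> 'b :: countable" and g :: "'a \<Rightarrow> 'c :: countable"
  assumes f: "f \<in> M \<rightarrow>\<^sub>M count_space UNIV" and g: "g \<in> M \<rightarrow>\<^sub>M count_space UNIV"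
  shows "(\<lambda>x. h (f x) (g x)) \<in> M \<rightarrow>\<^sub>M count_space UNIV"
proof -
  have "(\<lambda>x. h i (g x)) \<in> M \<rightarrow>\<^sub>M count_space UNIV" for i
    by (rule measurable_compose[OF g]) simp
  then show ?thesis by (rule measurable_compose_countable[OF _ f])
qed

lemma pred_eq_countable:
  fixes f g :: "'a \<Rightarrow> 'b :: countable"
  assumes "f \<in> M \<rightarrow>\<^sub>M count_space UNIV" "g \<in> M \<rightarrow>\<^sub>M count_space UNIV"
  shows "Measurable.pred M (\<lambda>x. f x = g x)"
  using measurable_count_space_binop[OF assms, of "(=)"] .

lemma measurable_path_component [measurable]: "(\<lambda>s. s m) \<in> path_space \<rightarrow>\<^sub>M count_space UNIV"
  unfolding path_space_def by (rule measurable_component_singleton) simp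

lemma measurable_path_spaceI:
  assumes "\<And>m. (\<lambda>x. f x m) \<in> M \<rightarrow>\<^sub>M count_space UNIV"
  shows "f \<in> M \<rightarrow>\<^sub>M path_space"
  unfolding path_space_def by (rule measurable_PiM_single') (use assms in auto)

lemma space_path_space [simp]: "space path_space = UNIV"
  by (simp add: path_space_def space_PiM)

lemma pred_path_eq: "Measurable.pred path_space (\<lambda>s. s m = s k)"
  by (intro pred_eq_countable) measurable

lemma pred_path_offset: "Measurable.pred path_space (\<lambda>s. s m = s k + z)"
proof (rule pred_eq_countable)
  show "(\<lambda>s. s k + z) \<in> path_space \<rightarrow>\<^sub>M count_space UNIV"
    by (rule measurable_compose[OF measurable_path_component]) simp
qed measurable

lemma measurable_path_from [measurable]: "path_from i \<in> path_space \<rightarrow>\<^sub>M path_space"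
proof (rule measurable_path_spaceI)
  fix m
  show "(\<lambda>x. path_from i x m) \<in> path_space \<rightarrow>\<^sub>M count_space UNIV"
    unfolding path_from_def
    by (rule measurable_count_space_binop[where f="\<lambda>s. s (i + m)" and g="\<lambda>s. s i"]) measurable
qed

lemma measurable_uminus_path: "(\<lambda>s m. - s m) \<in> path_space \<rightarrow>\<^sub>M path_space"
  by (intro measurable_path_spaceI measurable_compose[OF measurable_path_component]) simp

text \<open>Trades finiteness for quantifiers over the naturals, under which measurability is
  preserved.\<close>

lemma finite_nat_iff_eventually: "finite {m :: nat. P m} \<longleftrightarrow> (\<exists>n. \<forall>m>n. \<not> P m)"
  using finite_nat_set_iff_bounded_le[of "{m. P m}"] by (auto simp: not_le[symmetric])

lemma pred_finite_path [measurable]: "Measurable.pred path_space (\<lambda>s. finite {m. s m = z})"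
  unfolding finite_nat_iff_eventually by measurable

lemma pred_returns [measurable]: "Measurable.pred path_space (returns q)"
proof -
  have "(\<lambda>s. card {m. 0 < m \<and> s m = (0 :: int ^ 'd)}) \<in> path_space \<rightarrow>\<^sub>M count_space UNIV"
    by measurable
  then have "Measurable.pred path_space (\<lambda>s. card {m. 0 < m \<and> s m = (0 :: int ^ 'd)} = q)"
    by measurable
  then show ?thesis unfolding returns_def[abs_def] finite_nat_iff_eventually by measurable
qed

lemma not_nbhd_subset_iff: "\<not> nbhd a \<subseteq> A \<longleftrightarrow> (\<exists>z\<in>nbhd 0. a + z \<notin> A)"
proof
  assume "\<not> nbhd a \<subseteq> A"
  then obtain y where "y \<in> nbhd a" "y \<notin> A" by blast
  then show "\<exists>z\<in>nbhd 0. a + z \<notin> A" by (intro bexI[of _ "y - a"]) (auto simp: mem_nbhd_iff[of y a])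
next
  assume "\<exists>z\<in>nbhd 0. a + z \<notin> A"
  then obtain z where "z \<in> nbhd 0" "a + z \<notin> A" by blast
  then show "\<not> nbhd a \<subseteq> A" using mem_nbhd_iff[of "a + z" a] by auto
qed

lemma countable_set_type [simp]: "countable (A :: 'a :: countable set)"
  by (rule countableI_type)

text \<open>Translating to the neighbourhood of 0 makes the range of the quantifier independent of
  the path. What remains is a countable combination of the events
  \<open>s m = s k + z\<close>.\<close>

lemma pred_nbhd_subset:
  fixes A :: "nat set"
  shows "Measurable.pred path_space (\<lambda>s :: nat \<Rightarrow> int ^ 'd. nbhd (s k) \<subseteq> s ` A)"
proof -
  have "(\<lambda>s :: nat \<Rightarrow> int ^ 'd. nbhd (s k) \<subseteq> s ` A) = (\<lambda>s. \<forall>z\<in>nbhd 0. \<exists>m\<in>A. s m = s k + z)"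
  proof
    fix s :: "nat \<Rightarrow> int ^ 'd"
    show "nbhd (s k) \<subseteq> s ` A \<longleftrightarrow> (\<forall>z\<in>nbhd 0. \<exists>m\<in>A. s m = s k + z)"
      using not_nbhd_subset_iff[of "s k" "s ` A"] by (force simp: image_iff)
  qed
  then show ?thesis
    by (simp only:) (intro measurable_pred_countable countable_set_type pred_path_offset)
qed

lemma pred_mem_image:
  fixes A :: "nat set"
  shows "Measurable.pred path_space (\<lambda>s :: nat \<Rightarrow> int ^ 'd. z \<in> s ` A)"
proof -
  have "Measurable.pred path_space (\<lambda>s :: nat \<Rightarrow> int ^ 'd. s m = z)" for m by measurable
  moreover have "(\<lambda>s :: nat \<Rightarrow> int ^ 'd. z \<in> s ` A) = (\<lambda>s. \<exists>m\<in>A. s m = z)" by (auto simp: fun_eq_iff)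
  ultimately show ?thesis
    by (simp only:) (intro measurable_pred_countable countable_set_type)
qed

lemma pred_mem_image_self:
  fixes A :: "nat set"
  shows "Measurable.pred path_space (\<lambda>s :: nat \<Rightarrow> int ^ 'd. s k \<in> s ` A)"
proof -
  have "(\<lambda>s :: nat \<Rightarrow> int ^ 'd. s k \<in> s ` A) = (\<lambda>s. \<exists>m\<in>A. s k = s m)" by (auto simp: fun_eq_iff)
  then show ?thesis
    by (simp only:) (intro measurable_pred_countable countable_set_type pred_path_eq)
qed

lemma pred_upper_event [measurable]: "Measurable.pred path_space (upper_event b q k)"
  unfolding upper_event_def[abs_def]
  by (intro pred_intros_logic pred_nbhd_subset pred_mem_image_self
      measurable_compose[OF measurable_path_from pred_returns]) simp

lemma pred_lower_event [measurable]: "Measurable.pred path_space (lower_event b q k)"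
  unfolding lower_event_def[abs_def]
  by (intro pred_intros_logic pred_intros_countable pred_path_eq pred_nbhd_subset pred_mem_image_self
      measurable_compose[OF measurable_path_from pred_returns]) simp_all

lemma pred_late_return [measurable]: "Measurable.pred path_space (late_return k)"
  unfolding late_return_def[abs_def] by measurable

lemma pred_late_visit [measurable]: "Measurable.pred path_space (late_visit k)"
proof -
  have "Measurable.pred path_space (\<lambda>s. (\<exists>m>k. s m = - z) \<and> finite {m. s m = - z})" for z
    by measurable
  then show ?thesis
    unfolding late_visit_def[abs_def] by (intro measurable_pred_countable countable_set_type)
qed

section \<open>Walks as functions of their increments\<close>

definition partial_sums :: "(nat \<Rightarrow> int ^ 'd) \<Rightarrow> nat \<Rightarrow> int ^ 'd" where
  "partial_sums x n = (\<Sum>i<n. x i)"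

lemma partial_sums_shift: "partial_sums (shift_seq i x) = path_from i (partial_sums x)"
proof
  fix m
  show "partial_sums (shift_seq i x) m = path_from i (partial_sums x) m"
    by (induction m) (auto simp: partial_sums_def path_from_def shift_seq_def)
qed

text \<open>Going back \<open>m\<close> steps from time \<open>k\<close> removes the last
  \<open>m\<close> of the first \<open>k\<close> increments. After the reversal these are the first
  \<open>m\<close> entries of \<open>x\<close>, so the past appears as the negative of a walk run
  forwards.\<close>

lemma partial_sums_rev_prefix:
  assumes "m \<le> k"
  shows "partial_sums (comb_seq k (rev_prefix k x) y) (k - m) - partial_sums (comb_seq k (rev_prefix k x) y) k
    = - partial_sums x m"
  using assms
proof (induction m)
  case (Suc m)
  let ?u = "comb_seq k (rev_prefix k x) y"
  have "partial_sums ?u (k - m) = partial_sums ?u (k - Suc m) + ?u (k - Suc m)"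
    using Suc.prems by (simp add: partial_sums_def flip: Suc_diff_Suc)
  moreover have "?u (k - Suc m) = x m" using Suc.prems by (simp add: comb_seq_def rev_prefix_def)
  ultimately have "partial_sums ?u (k - Suc m) - partial_sums ?u k = - partial_sums x m - x m"
    using Suc by (simp add: algebra_simps)
  then show ?case by (simp add: partial_sums_def)
qed (simp add: partial_sums_def)

section \<open>Limits in the truncation parameter\<close>

lemma tendsto_sandwich_family:
  fixes a :: "nat \<Rightarrow> real"
  assumes u: "\<And>k. u k \<longlonglongrightarrow> \<beta> k" "\<beta> \<longlonglongrightarrow> Q" "\<And>k n. a n \<le> u k n"
    and l: "\<And>k. l k \<longlonglongrightarrow> \<gamma> k" "\<gamma> \<longlonglongrightarrow> Q" "\<And>k n. l k n \<le> a n"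
  shows "a \<longlonglongrightarrow> Q"
proof (rule order_tendstoI)
  fix c assume "c < Q"
  then have "\<forall>\<^sub>F k in sequentially. c < \<gamma> k" by (rule order_tendstoD(1)[OF l(2)])
  then obtain k where "c < \<gamma> k" by (auto simp: eventually_sequentially)
  then have "\<forall>\<^sub>F n in sequentially. c < l k n" by (rule order_tendstoD(1)[OF l(1)])
  then show "\<forall>\<^sub>F n in sequentially. c < a n" by eventually_elim (rule less_le_trans[OF _ l(3)])
next
  fix c assume "Q < c"
  then have "\<forall>\<^sub>F k in sequentially. \<beta> k < c" by (rule order_tendstoD(2)[OF u(2)])
  then obtain k where "\<beta> k < c" by (auto simp: eventually_sequentially)
  then have "\<forall>\<^sub>F n in sequentially. u k n < c" by (rule order_tendstoD(2)[OF u(1)])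
  then show "\<forall>\<^sub>F n in sequentially. a n < c" by eventually_elim (rule le_less_trans[OF u(3)])
qed

text \<open>At each sample point the indicators become constant, hence converge; dominated
  convergence with bound 1 gives the probabilities.\<close>

lemma (in prob_space) prob_tendsto_eventually:
  assumes A: "\<And>k :: nat. Measurable.pred M (A k)" and L: "Measurable.pred M L"
    and ev: "\<And>x. \<forall>\<^sub>F k in sequentially. A k x = L x"
  shows "(\<lambda>k. \<P>(x in M. A k x)) \<longlonglongrightarrow> \<P>(x in M. L x)"
proof -
  have "(\<lambda>k. \<integral>x. indicator {x\<in>space M. A k x} x \<partial>M) \<longlonglongrightarrow> (\<integral>x. indicator {x\<in>space M. L x} x \<partial>M :: real)"
  proof (rule integral_dominated_convergence[where w="\<lambda>_. 1"])
    show "AE x in M. (\<lambda>k. indicator {x\<in>space M. A k x} x :: real) \<longlonglongrightarrow> indicator {x\<in>space M. L x} x"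
    proof (rule AE_I2)
      fix x
      have "\<forall>\<^sub>F k in sequentially. indicator {x\<in>space M. A k x} x = (indicator {x\<in>space M. L x} x :: real)"
        using ev[of x] by eventually_elim (simp add: indicator_def)
      then show "(\<lambda>k. indicator {x\<in>space M. A k x} x :: real) \<longlonglongrightarrow> indicator {x\<in>space M. L x} x"
        by (rule tendsto_eventually)
    qed
  qed (use A L in \<open>auto simp: indicator_def pred_def\<close>)
  then show ?thesis using A L by (simp add: pred_def)
qed

lemma eventually_mem_initial_image:
  fixes f :: "nat \<Rightarrow> 'a"
  shows "\<forall>\<^sub>F k in sequentially. (a \<in> f ` {i..k}) = (a \<in> f ` {i..})"
proof (cases "a \<in> f ` {i..}")
  case True
  then obtain m where "m \<ge> i" "a = f m" by auto
  then show ?thesis using True by (auto intro!: eventually_sequentiallyI[of m])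
next
  case False
  have "f ` {i..k} \<subseteq> f ` {i..}" for k by auto
  then show ?thesis using False by (intro always_eventually) blast
qed

lemma eventually_subset_initial_images:
  fixes f g :: "nat \<Rightarrow> 'a"
  assumes "finite N"
  shows "\<forall>\<^sub>F k in sequentially. (N \<subseteq> f ` {0..k} \<union> g ` {0..k}) = (N \<subseteq> range f \<union> range g)"
proof -
  have "\<forall>\<^sub>F k in sequentially. (a \<in> f ` {0..k} \<union> g ` {0..k}) = (a \<in> range f \<union> range g)" for a
    using eventually_mem_initial_image[of a f 0] eventually_mem_initial_image[of a g 0]
    by eventually_elim (simp add: atLeast_0)
  then have "\<forall>\<^sub>F k in sequentially. \<forall>a\<in>N. (a \<in> f ` {0..k} \<union> g ` {0..k}) = (a \<in> range f \<union> range g)"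
    using assms by (intro eventually_ball_finite) auto
  then show ?thesis by eventually_elim (auto simp: subset_iff)
qed

lemma eventually_subset_initial_image:
  fixes g :: "nat \<Rightarrow> 'a"
  assumes "finite N"
  shows "\<forall>\<^sub>F k in sequentially. (N \<subseteq> A \<union> g ` {0..k}) = (N \<subseteq> A \<union> range g)"
proof -
  have "\<forall>\<^sub>F k in sequentially. (a \<in> A \<union> g ` {0..k}) = (a \<in> A \<union> range g)" for a
    using eventually_mem_initial_image[of a g 0] by eventually_elim (simp add: atLeast_0)
  then have "\<forall>\<^sub>F k in sequentially. \<forall>a\<in>N. (a \<in> A \<union> g ` {0..k}) = (a \<in> A \<union> range g)"
    using assms by (intro eventually_ball_finite) auto
  then show ?thesis by eventually_elim (auto simp: subset_iff)
qed

text \<open>A return at time m excludes the event for every \<open>k\<close> from m on; a path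
  without returns never satisfies it.\<close>

lemma eventually_not_late_return: "\<forall>\<^sub>F k in sequentially. \<not> late_return k s"
proof (cases "\<exists>m>0. s m = 0")
  case True
  then obtain m where "m > 0" "s m = 0" by blast
  then show ?thesis by (intro eventually_sequentiallyI[of m]) (auto simp: late_return_def)
next
  case False
  then have "s m \<noteq> 0" if "m > k" for m k :: nat using that by (metis gr_implies_not0 gr0I)
  then show ?thesis by (intro always_eventually) (auto simp: late_return_def)
qed

text \<open>A displacement visited infinitely often is excluded by the event itself, and any other
  one is not visited after some time. Only finitely many displacements are tested, so a common
  threshold exists.\<close>

lemma eventually_not_late_visit: "\<forall>\<^sub>F k in sequentially. \<not> late_visit k s"
proof -
  have "\<forall>\<^sub>F k in sequentially. \<not> ((\<exists>m>k. s m = - z) \<and> finite {m. s m = - z})" for z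
  proof (cases "finite {m. s m = - z}")
    case True
    then obtain n where n: "\<forall>m>n. s m \<noteq> - z" unfolding finite_nat_iff_eventually by blast
    have "\<forall>\<^sub>F k in sequentially. k \<ge> n" by (rule eventually_ge_at_top)
    then show ?thesis by eventually_elim (use n in auto)
  qed simp
  then have "\<forall>\<^sub>F k in sequentially. \<forall>z\<in>insert 0 (nbhd 0). \<not> ((\<exists>m>k. s m = - z) \<and> finite {m. s m = - z})"
    using finite_nbhd by (intro eventually_ball_finite) auto
  then show ?thesis by eventually_elim (auto simp: late_visit_def)
qed

text \<open>Seen from time \<open>k\<close>, with future \<open>f\<close> and time-reversed past \<open>g\<close>.\<close>

lemma centred_events:
  fixes t f g :: "nat \<Rightarrow> int ^ 'd"
  assumes f: "\<And>m. t (k + m) - t k = f m" and g: "\<And>m. m \<le> k \<Longrightarrow> t (k - m) - t k = g m"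
  shows upper_event_centred: "upper_event b q k t \<longleftrightarrow> returns q f
      \<and> \<not> nbhd 0 \<subseteq> f ` {0..k} \<union> g ` {0..k} \<and> (b \<longrightarrow> 0 \<notin> g ` {1..k})" (is ?U)
    and lower_event_centred: "lower_event b q k t \<longleftrightarrow> returns q f \<and> (\<forall>m>k. f m \<noteq> 0)
      \<and> \<not> nbhd 0 \<subseteq> range f \<union> g ` {0..k} \<and> (b \<longrightarrow> 0 \<notin> g ` {1..k})" (is ?L)
proof -
  have pf: "path_from k t = f" using f by (auto simp: path_from_def)
  have past: "(\<lambda>m. t m - t k) ` {..k} = g ` {0..k}"
  proof (intro set_eqI iffI)
    fix a assume "a \<in> (\<lambda>m. t m - t k) ` {..k}"
    then obtain m where m: "m \<le> k" "a = t m - t k" by auto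
    then have "a = g (k - m)" using g[of "k - m"] by simp
    then show "a \<in> g ` {0..k}" by (intro image_eqI[of _ _ "k - m"]) auto
  next
    fix a assume "a \<in> g ` {0..k}"
    then obtain m where m: "m \<le> k" "a = g m" by auto
    then show "a \<in> (\<lambda>m. t m - t k) ` {..k}" using g[of m] by (intro image_eqI[of _ _ "k - m"]) auto
  qed
  have fut: "(\<lambda>m. t m - t k) ` ((+) k ` A) = f ` A" for A
    using f by (auto simp: image_image)
  have 1: "(\<lambda>m. t m - t k) ` {0..2 * k} = f ` {0..k} \<union> g ` {0..k}"
  proof -
    have "{0..2 * k} = (+) k ` {0..k} \<union> {..k}" by auto
    then show ?thesis using past fut[of "{0..k}"] by (simp only: image_Un)
  qed
  have 2: "(\<lambda>m. t m - t k) ` UNIV = range f \<union> g ` {0..k}"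
  proof -
    have U: "(UNIV :: nat set) = range ((+) k) \<union> {..k}" 
    proof -
      have "range ((+) k) = {k..}" by (auto simp: image_iff le_iff_add)
      moreover have "(UNIV :: nat set) = {k..} \<union> {..k}" by auto
      ultimately show ?thesis by simp
    qed
    have "(\<lambda>m. t m - t k) ` (range ((+) k) \<union> {..k}) = range f \<union> g ` {0..k}"
      by (simp only: image_Un past fut)
    then show ?thesis by (simp only: U[symmetric])
  qed
  have 3: "t k \<notin> t ` {..<k} \<longleftrightarrow> 0 \<notin> g ` {1..k}"
  proof -
    have "t k \<in> t ` {..<k} \<longleftrightarrow> (\<exists>m<k. t k = t m)" by auto
    also have "\<dots> \<longleftrightarrow> (\<exists>m. 1 \<le> m \<and> m \<le> k \<and> g m = 0)"
    proof (intro iffI; elim exE conjE)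
      fix m assume m: "m < k" "t k = t m"
      then have "g (k - m) = 0" using g[of "k - m"] by simp
      then show "\<exists>m. 1 \<le> m \<and> m \<le> k \<and> g m = 0" using m by (intro exI[of _ "k - m"]) auto
    next
      fix m assume m: "1 \<le> m" "m \<le> k" "g m = 0"
      then show "\<exists>m<k. t k = t m" using g[of m] by (intro exI[of _ "k - m"]) auto
    qed
    also have "\<dots> \<longleftrightarrow> 0 \<in> g ` {1..k}" by (auto simp: image_iff)
    finally show ?thesis by (simp only: not_not)
  qed
  have 4: "(\<forall>m>2 * k. t m \<noteq> t k) \<longleftrightarrow> (\<forall>m>k. f m \<noteq> 0)"
  proof
    assume *: "\<forall>m>2 * k. t m \<noteq> t k"
    show "\<forall>m>k. f m \<noteq> 0" 
    proof (intro allI impI)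
      fix m assume "m > k"
      then have "t (k + m) \<noteq> t k" using * by simp
      then show "f m \<noteq> 0" using f[of m] by auto
    qed
  next
    assume *: "\<forall>m>k. f m \<noteq> 0"
    show "\<forall>m>2 * k. t m \<noteq> t k"
    proof (intro allI impI)
      fix m assume "m > 2 * k"
      then have "m - k > k" "k + (m - k) = m" by auto
      then show "t m \<noteq> t k" using * f[of "m - k"] by force
    qed
  qed
  show ?U
    unfolding upper_event_def pf 3 nbhd_subset_translate[of "t k" "t k" t "{0..2 * k}", symmetric] 1 diff_self ..
  show ?L
    unfolding lower_event_def pf 3 4 nbhd_subset_translate[of "t k" "t k" t UNIV, symmetric] 2 diff_self ..
qed

section \<open>Almost sure convergence\<close>

text \<open>The common limit of \<open>upper_event\<close> and \<open>lower_event\<close>, with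
  \<open>f\<close> the future and \<open>g\<close> the reversed past. The \<open>q\<close> returns
  of \<open>f\<close> are what the independent copies replace later.\<close>

definition limit_event :: "bool \<Rightarrow> nat \<Rightarrow> (nat \<Rightarrow> int ^ 'd) \<Rightarrow> (nat \<Rightarrow> int ^ 'd) \<Rightarrow> bool" where
  "limit_event b q f g \<longleftrightarrow> returns q f \<and> \<not> nbhd 0 \<subseteq> range f \<union> range g \<and> (b \<longrightarrow> 0 \<notin> g ` {1..})"

locale lattice_walk = sequence_space D for D :: "(int ^ 'd) measure" +
  assumes sets_D: "sets D = UNIV"
begin

lemma measurable_partial_sums [measurable]: "partial_sums \<in> S \<rightarrow>\<^sub>M path_space"
proof (rule measurable_path_spaceI)
  fix n
  have "(\<lambda>x. x i) \<in> S \<rightarrow>\<^sub>M D" for i by measurable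
  moreover have "measurable S D = measurable S (count_space UNIV)"
    using sets_D by (intro measurable_cong_sets) auto
  ultimately have c: "(\<lambda>x. x i) \<in> S \<rightarrow>\<^sub>M count_space UNIV" for i by simp
  show "(\<lambda>x. partial_sums x n) \<in> S \<rightarrow>\<^sub>M count_space UNIV"
  proof (induction n)
    case (Suc n)
    then show ?case unfolding partial_sums_def
      by (simp only: sum.lessThan_Suc) (rule measurable_count_space_binop[OF _ c])
  qed (simp add: partial_sums_def)
qed

lemma measurable_future [measurable]: "(\<lambda>z. partial_sums (snd z)) \<in> S \<Otimes>\<^sub>M S \<rightarrow>\<^sub>M path_space"
  by measurable

lemma measurable_past: "(\<lambda>z m. - partial_sums (fst z) m) \<in> S \<Otimes>\<^sub>M S \<rightarrow>\<^sub>M path_space"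
  using measurable_compose[OF _ measurable_uminus_path, of "\<lambda>z. partial_sums (fst z)" "S \<Otimes>\<^sub>M S"]
  by measurable

lemma pred_limit_event:
  "Measurable.pred (S \<Otimes>\<^sub>M S) (\<lambda>z. limit_event b q (partial_sums (snd z)) (\<lambda>m. - partial_sums (fst z) m))"
proof -
  have "(\<lambda>z. \<not> nbhd 0 \<subseteq> range (partial_sums (snd z)) \<union> range (\<lambda>m. - partial_sums (fst z) m))
    = (\<lambda>z. \<exists>a\<in>nbhd (0 :: int ^ 'd). \<not> (a \<in> range (partial_sums (snd z)) \<or> a \<in> range (\<lambda>m. - partial_sums (fst z) m)))"
    by (auto simp: fun_eq_iff)
  moreover have "Measurable.pred (S \<Otimes>\<^sub>M S) \<dots>"
    by (intro measurable_pred_countable countable_set_type pred_intros_logic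
        measurable_compose[OF measurable_past pred_mem_image] measurable_compose[OF measurable_future pred_mem_image])
  ultimately have "Measurable.pred (S \<Otimes>\<^sub>M S) (\<lambda>z. \<not> nbhd 0 \<subseteq> range (partial_sums (snd z)) \<union> range (\<lambda>m. - partial_sums (fst z) m))"
    by simp
  moreover have "Measurable.pred (S \<Otimes>\<^sub>M S) (\<lambda>z. 0 \<in> (\<lambda>m. - partial_sums (fst z) m) ` {1..})"
    by (rule measurable_compose[OF measurable_past pred_mem_image])
  ultimately show ?thesis unfolding limit_event_def by measurable
qed

lemma partial_sums_centred:
  "partial_sums (comb_seq k u y) (k + m) - partial_sums (comb_seq k u y) k = partial_sums y m"
proof -
  have "partial_sums y = path_from k (partial_sums (comb_seq k u y))"
    using partial_sums_shift[of k "comb_seq k u y"] by simp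
  then show ?thesis by (simp add: path_from_def)
qed

lemma measurable_recentred_walk:
  "(\<lambda>z. partial_sums (comb_seq k (rev_prefix k (fst z)) (snd z))) \<in> S \<Otimes>\<^sub>M S \<rightarrow>\<^sub>M path_space"
proof (rule measurable_compose[OF _ measurable_partial_sums])
  show "(\<lambda>z. comb_seq k (rev_prefix k (fst z)) (snd z)) \<in> S \<Otimes>\<^sub>M S \<rightarrow>\<^sub>M S"
    by (rule measurable_comb_seq'[OF measurable_compose[OF measurable_fst measurable_rev_prefix] measurable_snd])
qed

text \<open>By \<open>prob_split\<close> the walk seen from time k is an independent pair of future
  and reversed past whose law is free of k. Only the inspected window depends on k, and the events
  stabilize as it grows.\<close>

lemma prob_upper_event_tendsto:
  "(\<lambda>k. \<P>(x in S. upper_event b q k (partial_sums x)))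
    \<longlonglongrightarrow> \<P>(z in S \<Otimes>\<^sub>M S. limit_event b q (partial_sums (snd z)) (\<lambda>m. - partial_sums (fst z) m))"
proof -
  interpret PP: pair_prob_space S S ..
  have *: "\<P>(x in S. upper_event b q k (partial_sums x)) =
      \<P>(z in S \<Otimes>\<^sub>M S. upper_event b q k (partial_sums (comb_seq k (rev_prefix k (fst z)) (snd z))))" for k
    by (rule prob_split[OF measurable_compose[OF measurable_partial_sums pred_upper_event]])
  show ?thesis unfolding *
  proof (rule PP.prob_tendsto_eventually[OF measurable_compose[OF measurable_recentred_walk pred_upper_event]
        pred_limit_event])
    fix z :: "(nat \<Rightarrow> int ^ 'd) \<times> (nat \<Rightarrow> int ^ 'd)"
    let ?f = "partial_sums (snd z)" and ?g = "\<lambda>m. - partial_sums (fst z) m"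
    have c: "upper_event b q k (partial_sums (comb_seq k (rev_prefix k (fst z)) (snd z))) \<longleftrightarrow> returns q ?f
        \<and> \<not> nbhd 0 \<subseteq> ?f ` {0..k} \<union> ?g ` {0..k} \<and> (b \<longrightarrow> 0 \<notin> ?g ` {1..k})" for k
      by (rule upper_event_centred) (simp_all only: partial_sums_centred partial_sums_rev_prefix)
    show "\<forall>\<^sub>F k in sequentially. upper_event b q k (partial_sums (comb_seq k (rev_prefix k (fst z)) (snd z)))
        = limit_event b q ?f ?g"
      using eventually_subset_initial_images[OF finite_nbhd, of 0 ?f ?g] eventually_mem_initial_image[of 0 ?g 1]
      by eventually_elim (simp only: c limit_event_def)
  qed
qed

lemma prob_lower_event_tendsto:
  "(\<lambda>k. \<P>(x in S. lower_event b q k (partial_sums x)))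
    \<longlonglongrightarrow> \<P>(z in S \<Otimes>\<^sub>M S. limit_event b q (partial_sums (snd z)) (\<lambda>m. - partial_sums (fst z) m))"
proof -
  interpret PP: pair_prob_space S S ..
  have *: "\<P>(x in S. lower_event b q k (partial_sums x)) =
      \<P>(z in S \<Otimes>\<^sub>M S. lower_event b q k (partial_sums (comb_seq k (rev_prefix k (fst z)) (snd z))))" for k
    by (rule prob_split[OF measurable_compose[OF measurable_partial_sums pred_lower_event]])
  show ?thesis unfolding *
  proof (rule PP.prob_tendsto_eventually[OF measurable_compose[OF measurable_recentred_walk pred_lower_event]
        pred_limit_event])
    fix z :: "(nat \<Rightarrow> int ^ 'd) \<times> (nat \<Rightarrow> int ^ 'd)"
    let ?f = "partial_sums (snd z)" and ?g = "\<lambda>m. - partial_sums (fst z) m"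
    have c: "lower_event b q k (partial_sums (comb_seq k (rev_prefix k (fst z)) (snd z))) \<longleftrightarrow> returns q ?f \<and> (\<forall>m>k. ?f m \<noteq> 0)
        \<and> \<not> nbhd 0 \<subseteq> range ?f \<union> ?g ` {0..k} \<and> (b \<longrightarrow> 0 \<notin> ?g ` {1..k})" for k
      by (rule lower_event_centred) (simp_all only: partial_sums_centred partial_sums_rev_prefix)
    \<comment> \<open>Finitely many returns have a last one, so for large k the ban on returns after
      time k follows from \<open>returns q\<close>.\<close>
    have "\<forall>\<^sub>F k in sequentially. returns q ?f \<longrightarrow> (\<forall>m>k. ?f m \<noteq> 0)"
    proof (cases "returns q ?f")
      case True
      then obtain n where n: "\<forall>m>n. \<not> (0 < m \<and> ?f m = 0)"
        unfolding returns_def finite_nat_iff_eventually by blast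
      have "\<forall>\<^sub>F k in sequentially. k \<ge> n" by (rule eventually_ge_at_top)
      then show ?thesis by eventually_elim (use n in auto)
    qed simp
    then show "\<forall>\<^sub>F k in sequentially. lower_event b q k (partial_sums (comb_seq k (rev_prefix k (fst z)) (snd z)))
        = limit_event b q ?f ?g"
      using eventually_subset_initial_image[OF finite_nbhd, of 0 "range ?f" ?g] eventually_mem_initial_image[of 0 ?g 1]
      unfolding c limit_event_def by eventually_elim blast
  qed
qed

lemma prob_late_tendsto_0:
  "(\<lambda>k. \<P>(x in S. late_return k (partial_sums x))) \<longlonglongrightarrow> 0"
  "(\<lambda>k. \<P>(x in S. late_visit k (partial_sums x))) \<longlonglongrightarrow> 0"
proof -
  have "(\<lambda>k. \<P>(x in S. late_return k (partial_sums x))) \<longlonglongrightarrow> \<P>(x in S. False)"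
    by (rule P.prob_tendsto_eventually)
      (intro measurable_compose[OF measurable_partial_sums pred_late_return] measurable_const,
        simp_all add: eventually_not_late_return)
  then show "(\<lambda>k. \<P>(x in S. late_return k (partial_sums x))) \<longlonglongrightarrow> 0" by simp
  have "(\<lambda>k. \<P>(x in S. late_visit k (partial_sums x))) \<longlonglongrightarrow> \<P>(x in S. False)"
    by (rule P.prob_tendsto_eventually)
      (intro measurable_compose[OF measurable_partial_sums pred_late_visit] measurable_const,
        simp_all add: eventually_not_late_visit)
  then show "(\<lambda>k. \<P>(x in S. late_visit k (partial_sums x))) \<longlonglongrightarrow> 0" by simp
qed

text \<open>For fixed k the counting inequalities bracket the frequency between quantities that
  converge by the ergodic theorem. Their limits approach \<open>Q\<close> from both sides as k
  grows, since the charged error events have vanishing probability. Only countably many k occur, so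
  one null set serves all of them.\<close>

theorem last_visits_frequency:
  "AE x in S. (\<lambda>n. real (card (last_visits b q (partial_sums x) n)) / real n)
    \<longlonglongrightarrow> \<P>(z in S \<Otimes>\<^sub>M S. limit_event b q (partial_sums (snd z)) (\<lambda>m. - partial_sums (fst z) m))"
proof -
  define Q where "Q = \<P>(z in S \<Otimes>\<^sub>M S. limit_event b q (partial_sums (snd z)) (\<lambda>m. - partial_sums (fst z) m))"
  define freq where "freq A x n = real (card {i. i \<le> n \<and> A (path_from i (partial_sums x))})"
    for A :: "(nat \<Rightarrow> int ^ 'd) \<Rightarrow> bool" and x n
  have fr: "AE x in S. \<forall>k. (\<lambda>n. freq (A k) x n / real n) \<longlonglongrightarrow> \<P>(x in S. A k (partial_sums x))"
    if A: "\<And>k. Measurable.pred path_space (A k)" for A :: "nat \<Rightarrow> (nat \<Rightarrow> int ^ 'd) \<Rightarrow> bool"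
  proof -
    have "AE x in S. (\<lambda>n. freq (A k) x n / real n) \<longlonglongrightarrow> \<P>(x in S. A k (partial_sums x))" for k
      using frequency_shift[OF measurable_compose[OF measurable_partial_sums A], of k]
      unfolding freq_def partial_sums_shift .
    then show ?thesis by (simp add: AE_all_countable)
  qed
  from fr[of "upper_event b q", OF pred_upper_event] fr[of "lower_event b q", OF pred_lower_event]
    fr[of late_return, OF pred_late_return] fr[of late_visit, OF pred_late_visit]
  show ?thesis unfolding Q_def[symmetric]
  proof eventually_elim
    case (elim x)
    let ?c = "real (card (insert 0 (nbhd (0 :: int ^ 'd))))"
    have k0: "(\<lambda>n. real a / real n) \<longlonglongrightarrow> 0" for a by (rule lim_const_over_n)
    show ?case
    proof (rule tendsto_sandwich_family)
      fix k
      show "(\<lambda>n. freq (upper_event b q k) x n / real n + freq (late_return k) x n / real n + real (3 * k) / real n)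
        \<longlonglongrightarrow> \<P>(x in S. upper_event b q k (partial_sums x)) + \<P>(x in S. late_return k (partial_sums x)) + 0"
        by (intro tendsto_add k0 elim(1)[THEN spec] elim(3)[THEN spec])
      show "(\<lambda>n. freq (lower_event b q k) x n / real n - ?c * (freq (late_visit k) x n / real n) - real (2 * k) / real n)
        \<longlonglongrightarrow> \<P>(x in S. lower_event b q k (partial_sums x)) - ?c * \<P>(x in S. late_visit k (partial_sums x)) - 0"
        by (intro tendsto_diff tendsto_mult tendsto_const k0 elim(2)[THEN spec] elim(4)[THEN spec])
      fix n
      have "real (card (last_visits b q (partial_sums x) n))
          \<le> freq (upper_event b q k) x n + freq (late_return k) x n + real (3 * k)"
        using card_last_visits_le[of b q "partial_sums x" n k] unfolding freq_def by linarith
      from divide_right_mono[OF this, of "real n"]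
      show "real (card (last_visits b q (partial_sums x) n)) / real n
          \<le> freq (upper_event b q k) x n / real n + freq (late_return k) x n / real n + real (3 * k) / real n"
        by (simp only: add_divide_distrib)
      have "freq (lower_event b q k) x n \<le> real (card (last_visits b q (partial_sums x) n)
          + card (insert 0 (nbhd (0 :: int ^ 'd))) * card {j. j \<le> n \<and> late_visit k (path_from j (partial_sums x))} + 2 * k)"
        using card_lower_event_le[of n b q k "partial_sums x"] unfolding freq_def of_nat_le_iff .
      then have "freq (lower_event b q k) x n - ?c * freq (late_visit k) x n - real (2 * k)
          \<le> real (card (last_visits b q (partial_sums x) n))"
        unfolding freq_def of_nat_add of_nat_mult by linarith
      from divide_right_mono[OF this, of "real n"]
      show "freq (lower_event b q k) x n / real n - ?c * (freq (late_visit k) x n / real n) - real (2 * k) / real n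
          \<le> real (card (last_visits b q (partial_sums x) n)) / real n"
        by (simp only: diff_divide_distrib times_divide_eq_right)
    next
      show "(\<lambda>k. \<P>(x in S. upper_event b q k (partial_sums x)) + \<P>(x in S. late_return k (partial_sums x)) + 0) \<longlonglongrightarrow> Q"
        using tendsto_add[OF tendsto_add[OF prob_upper_event_tendsto[of b q] prob_late_tendsto_0(1)] tendsto_const[of 0]]
        by (simp only: Q_def add_0_right mult_zero_right diff_0_right)
      show "(\<lambda>k. \<P>(x in S. lower_event b q k (partial_sums x)) - ?c * \<P>(x in S. late_visit k (partial_sums x)) - 0) \<longlonglongrightarrow> Q"
        using tendsto_diff[OF tendsto_diff[OF prob_lower_event_tendsto[of b q]
            tendsto_mult[OF tendsto_const[of ?c] prob_late_tendsto_0(2)]] tendsto_const[of 0]]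
        by (simp only: Q_def add_0_right mult_zero_right diff_0_right)
    qed
  qed
qed

end

section \<open>Identification of the limit\<close>

text \<open>The surviving terms come from the subsets of \<open>N - U\<close>, whose signed count is
  0 unless that set is empty. In the induction, adding the new element reverses the sign of a term
  if the element lies outside \<open>U\<close> and annihilates the term otherwise.\<close>

lemma alternating_sum_Pow_avoid:
  assumes "finite N"
  shows "(\<Sum>B\<in>Pow N. (- 1) ^ card B * (if B \<inter> U = {} then 1 else 0)) = (if N \<subseteq> U then 1 else 0 :: real)"
  using assms
proof (induction N)
  case (insert a N)
  let ?g = "\<lambda>B. (- 1) ^ card B * (if B \<inter> U = {} then 1 else 0) :: real"
  have disj: "Pow N \<inter> insert a ` Pow N = {}" using insert(2) by blast
  have inj: "inj_on (insert a) (Pow N)" using insert(2) by (intro inj_onI) (metis PowD insert_ident subsetD)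
  have "(\<Sum>B\<in>insert a ` Pow N. ?g B) = (\<Sum>B\<in>Pow N. ?g (insert a B))"
    by (simp add: sum.reindex[OF inj])
  also have "\<dots> = (\<Sum>B\<in>Pow N. - (if a \<in> U then 0 else 1) * ?g B)"
  proof (rule sum.cong)
    fix B assume "B \<in> Pow N"
    then have "finite B" "a \<notin> B" using insert finite_subset by auto
    then show "?g (insert a B) = - (if a \<in> U then 0 else 1) * ?g B" by auto
  qed simp
  also have "\<dots> = - (if a \<in> U then 0 else 1) * (if N \<subseteq> U then 1 else 0)"
    by (simp only: sum_distrib_left[symmetric] insert.IH)
  finally have "(\<Sum>B\<in>Pow (insert a N). ?g B) = (if N \<subseteq> U then 1 else 0) - (if a \<in> U then 0 else 1) * (if N \<subseteq> U then 1 else 0)"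
    using insert(1) by (simp add: Pow_insert sum.union_disjoint[OF _ _ disj] insert.IH)
  then show ?case by auto
qed simp

text \<open>Inclusion-exclusion turns covering events into avoidance events, whose probabilities
  factorize over independent walks.\<close>

lemma (in prob_space) prob_not_covering:
  assumes N: "finite N" and E: "Measurable.pred M E" and U: "\<And>a. Measurable.pred M (\<lambda>x. a \<in> U x)"
  shows "\<P>(x in M. E x \<and> \<not> N \<subseteq> U x)
    = \<P>(x in M. E x \<and> {} \<inter> U x = {}) - (\<Sum>B\<in>Pow N. (- 1) ^ card B * \<P>(x in M. E x \<and> B \<inter> U x = {}))"
proof -
  define V where "V B = {x \<in> space M. E x \<and> B \<inter> U x = {}}" for B
  have V: "V B \<in> events" if "B \<subseteq> N" for B
  proof -
    have "countable B" using N that by (meson countable_finite finite_subset)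
    then have "Measurable.pred M (\<lambda>x. \<forall>a\<in>B. \<not> a \<in> U x)"
      by (rule measurable_pred_countable) (intro pred_intros_logic U)
    then have "Measurable.pred M (\<lambda>x. E x \<and> (\<forall>a\<in>B. \<not> a \<in> U x))" by (intro pred_intros_logic E)
    moreover have "V B = {x \<in> space M. E x \<and> (\<forall>a\<in>B. \<not> a \<in> U x)}" by (auto simp: V_def)
    ultimately show ?thesis by (simp add: pred_def)
  qed
  \<comment> \<open>Avoiding the empty set is no restriction, so \<open>V {}\<close> is the event
    \<open>E\<close> itself. Writing it this way lets the same factorization formula handle every
    term.\<close>
  have eq: "indicator {x \<in> space M. E x \<and> \<not> N \<subseteq> U x} x
      = indicator (V {}) x - (\<Sum>B\<in>Pow N. (- 1) ^ card B * indicator (V B) x :: real)" if "x \<in> space M" for x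
  proof (cases "E x")
    case True
    then have "indicator (V B) x = (if B \<inter> U x = {} then 1 else 0 :: real)" for B
      using that by (auto simp: V_def)
    then show ?thesis using True that alternating_sum_Pow_avoid[OF N, of "U x"] by (simp add: indicator_def)
  next
    case False
    then show ?thesis by (simp add: V_def)
  qed
  have "Measurable.pred M (\<lambda>x. \<exists>a\<in>N. \<not> a \<in> U x)"
    using countable_finite[OF N] by (rule measurable_pred_countable) (intro pred_intros_logic U)
  then have "Measurable.pred M (\<lambda>x. E x \<and> (\<exists>a\<in>N. \<not> a \<in> U x))" by (intro pred_intros_logic E)
  moreover have "{x \<in> space M. E x \<and> \<not> N \<subseteq> U x} = {x \<in> space M. E x \<and> (\<exists>a\<in>N. \<not> a \<in> U x)}" by auto
  ultimately have X: "{x \<in> space M. E x \<and> \<not> N \<subseteq> U x} \<in> events" by (simp add: pred_def)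
  have int: "integrable M (indicator A :: _ \<Rightarrow> real)" if "A \<in> events" for A
    using that by (simp add: integrable_indicator_iff less_top[symmetric])
  have ind: "(\<integral>x. indicator A x \<partial>M) = prob A" if "A \<in> events" for A
    using that sets.sets_into_space[OF that] by (simp add: Int_absorb2)
  have "\<P>(x in M. E x \<and> \<not> N \<subseteq> U x) = (\<integral>x. indicator {x \<in> space M. E x \<and> \<not> N \<subseteq> U x} x \<partial>M)"
    using ind[OF X] by simp
  also have "\<dots> = (\<integral>x. indicator (V {}) x - (\<Sum>B\<in>Pow N. (- 1) ^ card B * indicator (V B) x) \<partial>M)"
    using eq by (rule Bochner_Integration.integral_cong[OF refl])
  also have "\<dots> = prob (V {}) - (\<Sum>B\<in>Pow N. (- 1) ^ card B * prob (V B))"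
  proof -
    have V0: "V {} \<in> events" by (rule V) simp
    have summand: "integrable M (\<lambda>x. (- 1) ^ card B * indicator (V B) x :: real)" if "B \<in> Pow N" for B
      using int[OF V] that by (intro integrable_mult_right) auto
    have "(\<integral>x. (\<Sum>B\<in>Pow N. (- 1) ^ card B * indicator (V B) x :: real) \<partial>M)
        = (\<Sum>B\<in>Pow N. \<integral>x. (- 1) ^ card B * indicator (V B) x \<partial>M)"
      by (rule Bochner_Integration.integral_sum) (rule summand)
    also have "\<dots> = (\<Sum>B\<in>Pow N. (- 1) ^ card B * prob (V B))"
      using V ind by (intro sum.cong refl) (simp del: Bochner_Integration.integral_indicator)
    finally have sum: "(\<integral>x. (\<Sum>B\<in>Pow N. (- 1) ^ card B * indicator (V B) x) \<partial>M)
        = (\<Sum>B\<in>Pow N. (- 1) ^ card B * prob (V B))" .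
    have "integrable M (\<lambda>x. \<Sum>B\<in>Pow N. (- 1) ^ card B * indicator (V B) x :: real)"
      by (rule Bochner_Integration.integrable_sum) (rule summand)
    from Bochner_Integration.integral_diff[OF int[OF V0] this] show ?thesis
      unfolding sum ind[OF V0] .
  qed
  finally show ?thesis unfolding V_def .
qed

section \<open>Decomposition of a path at its first return\<close>

definition first_return :: "nat \<Rightarrow> (nat \<Rightarrow> int ^ 'd) \<Rightarrow> bool" where
  "first_return t s \<longleftrightarrow> 0 < t \<and> s t = 0 \<and> (\<forall>m. 0 < m \<and> m < t \<longrightarrow> s m \<noteq> 0)"

text \<open>The probability of this event is the factor contributed by one excursion. It is phrased
  with \<open>hitting_time\<close> to match the copies in the theorem;
  \<open>avoiding_return_iff\<close> gives the form suited to splitting at the first return.\<close>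

definition avoiding_return :: "(int ^ 'd) set \<Rightarrow> (nat \<Rightarrow> int ^ 'd) \<Rightarrow> bool" where
  "avoiding_return B s \<longleftrightarrow> 0 \<in> s ` {1..} \<and> B \<inter> sites_upto s (hitting_time 0 s) = {}"

definition avoiding_escape :: "(int ^ 'd) set \<Rightarrow> (nat \<Rightarrow> int ^ 'd) \<Rightarrow> bool" where
  "avoiding_escape B s \<longleftrightarrow> 0 \<notin> s ` {1..} \<and> B \<inter> range s = {}"

lemma first_return_unique: "first_return t s \<Longrightarrow> first_return u s \<Longrightarrow> t = u"
  unfolding first_return_def by (cases t u rule: linorder_cases) blast+

lemma zero_mem_later_iff: "0 \<in> s ` {1..} \<longleftrightarrow> (\<exists>m::nat. 0 < m \<and> s m = 0)"
proof
  assume "0 \<in> s ` {1..}"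
  then obtain m where "m \<in> {1..}" "0 = s m" by (rule imageE)
  then have "0 < m \<and> s m = 0" by simp
  then show "\<exists>m. 0 < m \<and> s m = 0" by blast
next
  assume "\<exists>m. 0 < m \<and> s m = 0"
  then obtain m where "0 < m" "s m = 0" by blast
  then show "0 \<in> s ` {1..}" by (intro image_eqI[of _ _ m]) simp_all
qed

lemma ex_first_return: "0 \<in> s ` {1..} \<longleftrightarrow> (\<exists>t. first_return t s)"
proof
  assume "0 \<in> s ` {1..}"
  then have ex: "\<exists>m. 0 < m \<and> s m = 0" unfolding zero_mem_later_iff .
  define t where "t = (LEAST m. 0 < m \<and> s m = 0)"
  have "0 < t \<and> s t = 0" unfolding t_def using ex by (rule LeastI_ex)
  moreover have "s m \<noteq> 0" if "0 < m" "m < t" for m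
  proof
    assume "s m = 0"
    then have "0 < m \<and> s m = 0" using that by simp
    then have "t \<le> m" unfolding t_def by (rule Least_le)
    then show False using that by simp
  qed
  ultimately show "\<exists>t. first_return t s" unfolding first_return_def by blast
next
  assume "\<exists>t. first_return t s"
  then show "0 \<in> s ` {1..}" unfolding first_return_def zero_mem_later_iff by blast
qed

lemma sites_upto_first_return:
  assumes "first_return t s"
  shows "sites_upto s (hitting_time 0 s) = s ` {0..t}"
proof -
  have "hitting_time 0 s = enat t"
    unfolding hitting_time_def
  proof (rule antisym)
    show "Inf {enat m |m. 1 \<le> m \<and> s m = 0} \<le> enat t"
      using assms by (intro Inf_lower) (auto simp: first_return_def)
    show "enat t \<le> Inf {enat m |m. 1 \<le> m \<and> s m = 0}"
    proof (rule Inf_greatest)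
      fix e assume "e \<in> {enat m |m. 1 \<le> m \<and> s m = 0}"
      then obtain m where m: "e = enat m" "1 \<le> m" "s m = 0" by blast
      then have "\<not> m < t" using assms by (auto simp: first_return_def)
      then show "enat t \<le> e" using m by simp
    qed
  qed
  then show ?thesis by (auto simp: sites_upto_def)
qed

lemma avoiding_return_iff: "avoiding_return B s \<longleftrightarrow> (\<exists>t. first_return t s \<and> B \<inter> s ` {0..t} = {})"
  unfolding avoiding_return_def ex_first_return
  using sites_upto_first_return first_return_unique by metis

lemma returns_0_iff: "returns 0 s \<longleftrightarrow> 0 \<notin> s ` {1..}"
proof -
  have *: "finite A \<and> card A = 0 \<longleftrightarrow> A = {}" for A :: "nat set" by auto
  have "returns 0 s \<longleftrightarrow> {m. 0 < m \<and> s m = 0} = {}"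
    unfolding returns_def by (rule *)
  also have "\<dots> \<longleftrightarrow> 0 \<notin> s ` {1..}" unfolding zero_mem_later_iff by (simp only: Collect_empty_eq not_ex)
  finally show ?thesis .
qed

lemma returns_Suc_first_return:
  assumes "first_return t s"
  shows "returns (Suc q) s \<longleftrightarrow> returns q (path_from t s)"
proof -
  have t: "0 < t" "s t = 0" "\<And>m. 0 < m \<Longrightarrow> m < t \<Longrightarrow> s m \<noteq> 0"
    using assms(1) unfolding first_return_def by blast+
  have eq: "{m. 0 < m \<and> s m = 0} = insert t {m. t < m \<and> s m = s t}"
  proof (intro set_eqI iffI)
    fix m assume "m \<in> {m. 0 < m \<and> s m = 0}"
    then show "m \<in> insert t {m. t < m \<and> s m = s t}" using t(2) t(3)[of m] by (cases m t rule: linorder_cases) simp_all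
  next
    fix m assume "m \<in> insert t {m. t < m \<and> s m = s t}"
    then show "m \<in> {m. 0 < m \<and> s m = 0}" using t(1,2) by (elim insertE) simp_all
  qed
  define A where "A = {m. t < m \<and> s m = s t}"
  have "t \<notin> A" by (simp add: A_def)
  then have "finite (insert t A) \<and> card (insert t A) = Suc q \<longleftrightarrow> finite A \<and> card A = q"
    by (cases "finite A") simp_all
  then show ?thesis unfolding returns_path_from returns_def[of "Suc q"] eq A_def .
qed

lemma range_split_path_from:
  assumes "s t = 0"
  shows "range s = s ` {0..t} \<union> range (path_from t s)"
proof -
  have "range ((+) t) = {t..}" by (auto simp: image_iff le_iff_add)
  moreover have "(UNIV :: nat set) = {0..t} \<union> {t..}" by auto
  ultimately have "range s = s ` {0..t} \<union> s ` range ((+) t)" by (metis image_Un)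
  moreover have "s ` range ((+) t) = range (path_from t s)"
    using assms by (auto simp: path_from_def image_image)
  ultimately show ?thesis by simp
qed

text \<open>The first return separates a condition on the steps up to \<open>t\<close> from the same
  event with one return fewer for the restarted path. As the path is at 0 at time \<open>t\<close>,
  the set \<open>B\<close> stays the same after the restart.\<close>

lemma returns_Suc_avoiding_iff:
  shows "returns (Suc q) s \<and> B \<inter> range s = {} \<longleftrightarrow> (\<exists>t. (first_return t s \<and> B \<inter> s ` {0..t} = {})
    \<and> returns q (path_from t s) \<and> B \<inter> range (path_from t s) = {})"
proof
  assume *: "returns (Suc q) s \<and> B \<inter> range s = {}"
  have "\<exists>t. first_return t s"
  proof (rule ccontr)
    assume "\<nexists>t. first_return t s"
    then have "returns 0 s" unfolding returns_0_iff ex_first_return .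
    then show False using * by (simp add: returns_def)
  qed
  then obtain t where t: "first_return t s" by blast
  then have "s t = 0" by (simp add: first_return_def)
  then show "\<exists>t. (first_return t s \<and> B \<inter> s ` {0..t} = {}) \<and> returns q (path_from t s) \<and> B \<inter> range (path_from t s) = {}"
    using * t returns_Suc_first_return[OF t] range_split_path_from[of s t] by blast
next
  assume "\<exists>t. (first_return t s \<and> B \<inter> s ` {0..t} = {}) \<and> returns q (path_from t s) \<and> B \<inter> range (path_from t s) = {}"
  then obtain t where t: "first_return t s" "B \<inter> s ` {0..t} = {}" "returns q (path_from t s)" "B \<inter> range (path_from t s) = {}"
    by blast
  then have "s t = 0" by (simp add: first_return_def)
  then show "returns (Suc q) s \<and> B \<inter> range s = {}"
    using t returns_Suc_first_return[OF t(1)] range_split_path_from[of s t] by blast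
qed

lemma pred_avoid:
  fixes A :: "nat set"
  shows "Measurable.pred path_space (\<lambda>s :: nat \<Rightarrow> int ^ 'd. B \<inter> s ` A = {})"
proof -
  have "(\<lambda>s :: nat \<Rightarrow> int ^ 'd. B \<inter> s ` A = {}) = (\<lambda>s. \<forall>a\<in>B. \<not> a \<in> s ` A)" by (auto simp: fun_eq_iff)
  then show ?thesis
    by (simp only:) (intro measurable_pred_countable countable_set_type pred_intros_logic pred_mem_image)
qed

lemma pred_first_return: "Measurable.pred path_space (first_return t)"
  unfolding first_return_def[abs_def] by measurable

lemma pred_avoiding_return: "Measurable.pred path_space (avoiding_return B)"
  unfolding avoiding_return_iff[abs_def]
  by (intro pred_intros_countable pred_intros_logic pred_first_return pred_avoid)

lemma pred_avoiding_escape: "Measurable.pred path_space (avoiding_escape B)"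
  unfolding avoiding_escape_def[abs_def] by (intro pred_intros_logic pred_mem_image pred_avoid)

lemma pred_avoiding_past:
  "Measurable.pred path_space (\<lambda>s. (b \<longrightarrow> 0 \<notin> s ` {1..}) \<and> B \<inter> range s = {})"
proof (cases b)
  case True
  then show ?thesis by (simp only: simp_thms) (intro pred_intros_logic pred_mem_image pred_avoid)
next
  case False
  then show ?thesis by (simp only: simp_thms) (rule pred_avoid)
qed

section \<open>Factorization at the returns to the origin\<close>

context lattice_walk
begin

lemma prob_pair_indep:
  assumes A: "Measurable.pred S A" and B: "Measurable.pred S B"
  shows "\<P>(z in S \<Otimes>\<^sub>M S. A (fst z) \<and> B (snd z)) = \<P>(x in S. A x) * \<P>(x in S. B x)"
proof -
  have "{z \<in> space (S \<Otimes>\<^sub>M S). A (fst z) \<and> B (snd z)} = {x \<in> space S. A x} \<times> {x \<in> space S. B x}"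
    by (auto simp: space_pair_measure)
  then show ?thesis
    using P.emeasure_pair_measure_Times[of "{x \<in> space S. A x}" S "{x \<in> space S. B x}"] A B
    by (simp add: measure_def enn2real_mult pred_def)
qed

text \<open>By \<open>prefix\<close>, \<open>A\<close> depends only on the first \<open>t\<close>
  entries, while \<open>R\<close> is applied to those from \<open>t\<close> onwards. This is the
  Markov property at a fixed time.\<close>

lemma prob_prefix_shift:
  assumes A: "Measurable.pred S A" and R: "Measurable.pred S R"
    and prefix: "\<And>x y. A (comb_seq t x y) = A x"
  shows "\<P>(x in S. A x \<and> R (shift_seq t x)) = \<P>(x in S. A x) * \<P>(x in S. R x)"
proof -
  have m: "Measurable.pred S (\<lambda>x. A x \<and> R (shift_seq t x))"
    by (intro pred_intros_logic A measurable_compose[OF measurable_shift_seq R])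
  have "\<P>(x in S. A x \<and> R (shift_seq t x)) = \<P>(x in distr (S \<Otimes>\<^sub>M S) S (\<lambda>(x, y). comb_seq t x y). A x \<and> R (shift_seq t x))"
    unfolding PiM_comb_seq ..
  also have "\<dots> = \<P>(z in S \<Otimes>\<^sub>M S. A (fst z) \<and> R (snd z))"
    by (subst measure_distr_Collect[OF measurable_comb_seq m]) (simp add: case_prod_beta prefix)
  finally show ?thesis using prob_pair_indep[OF A R] by simp
qed

text \<open>The strong Markov property at the first return to the origin.\<close>

lemma prob_returns_avoiding:
  "\<P>(x in S. returns q (partial_sums x) \<and> B \<inter> range (partial_sums x) = {})
    = \<P>(x in S. avoiding_return B (partial_sums x)) ^ q * \<P>(x in S. avoiding_escape B (partial_sums x))"
proof (induction q)
  case 0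
  show ?case by (simp add: returns_0_iff avoiding_escape_def)
next
  case (Suc q)
  define A where "A t x \<longleftrightarrow> first_return t (partial_sums x) \<and> B \<inter> partial_sums x ` {0..t} = {}" for t x
  define R where "R x \<longleftrightarrow> returns q (partial_sums x) \<and> B \<inter> range (partial_sums x) = {}" for x
  have Am: "Measurable.pred S (A t)" for t
    unfolding A_def[abs_def]
    by (rule measurable_compose[OF measurable_partial_sums]) (intro pred_intros_logic pred_first_return pred_avoid)
  have Rm: "Measurable.pred S R"
    unfolding R_def[abs_def]
    by (rule measurable_compose[OF measurable_partial_sums]) (intro pred_intros_logic pred_returns pred_avoid)
  have ARm: "Measurable.pred S (\<lambda>x. A t x \<and> R (shift_seq t x))" for t
    by (intro pred_intros_logic Am measurable_compose[OF measurable_shift_seq Rm])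
  have prefix: "A t (comb_seq t x y) = A t x" for t x y
  proof -
    have ps: "partial_sums (comb_seq t x y) m = partial_sums x m" if "m \<le> t" for m
      using that by (auto simp: partial_sums_def comb_seq_def intro!: sum.cong)
    have "first_return t (partial_sums (comb_seq t x y)) = first_return t (partial_sums x)"
      using ps by (auto simp: first_return_def)
    moreover have "partial_sums (comb_seq t x y) ` {0..t} = partial_sums x ` {0..t}"
      using ps by (intro image_cong) auto
    ultimately show ?thesis unfolding A_def by simp
  qed
  \<comment> \<open>Uniqueness of the first return time gives disjointness over \<open>t\<close>.
    The slot \<open>Z\<close> is filled with the event for the shifted sequence in \<open>1\<close>
    and with \<open>True\<close> in \<open>2\<close>.\<close>
  have disj: "disjoint_family (\<lambda>t. {x \<in> space S. A t x \<and> Z t x})" for Z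
    unfolding disjoint_family_on_def A_def using first_return_unique by blast
  have "returns (Suc q) (partial_sums x) \<and> B \<inter> range (partial_sums x) = {} \<longleftrightarrow> (\<exists>t. A t x \<and> R (shift_seq t x))" for x
    unfolding A_def R_def partial_sums_shift by (rule returns_Suc_avoiding_iff)
  then have 1: "{x \<in> space S. returns (Suc q) (partial_sums x) \<and> B \<inter> range (partial_sums x) = {}}
      = (\<Union>t. {x \<in> space S. A t x \<and> R (shift_seq t x)})" by blast
  have 2: "{x \<in> space S. avoiding_return B (partial_sums x)} = (\<Union>t. {x \<in> space S. A t x \<and> True})"
    unfolding A_def avoiding_return_iff by blast
  have "(\<lambda>t. \<P>(x in S. A t x \<and> R (shift_seq t x)))
      sums \<P>(x in S. returns (Suc q) (partial_sums x) \<and> B \<inter> range (partial_sums x) = {})"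
    unfolding 1 using ARm by (intro P.finite_measure_UNION disj) (auto simp: pred_def)
  moreover have "(\<lambda>t. \<P>(x in S. A t x \<and> True)) sums \<P>(x in S. avoiding_return B (partial_sums x))"
    unfolding 2 using Am by (intro P.finite_measure_UNION disj) (auto simp: pred_def)
  then have "(\<lambda>t. \<P>(x in S. A t x) * \<P>(x in S. R x)) sums (\<P>(x in S. avoiding_return B (partial_sums x)) * \<P>(x in S. R x))"
    by (intro sums_mult2) simp
  ultimately have "\<P>(x in S. returns (Suc q) (partial_sums x) \<and> B \<inter> range (partial_sums x) = {})
      = \<P>(x in S. avoiding_return B (partial_sums x)) * \<P>(x in S. R x)"
    unfolding prob_prefix_shift[OF Am Rm prefix] by (rule sums_unique2)
  then show ?case using Suc unfolding R_def by simp
qed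

end

section \<open>Agreement of the limit with the probability for independent walks\<close>

lemma pred_conj:
  assumes [measurable]: "Measurable.pred M P" "Measurable.pred M Q"
  shows "Measurable.pred M (\<lambda>x. P x \<and> Q x)"
  by measurable

text \<open>Expresses membership in the stopped path through events already known to be measurable.
  Without a return the hitting time is infinite and the whole range counts; with a return,
  membership is the failure to avoid the singleton.\<close>

lemma mem_sites_upto_iff:
  "a \<in> sites_upto s (hitting_time 0 s) \<longleftrightarrow>
    (\<not> 0 \<in> s ` {1..} \<and> a \<in> range s) \<or> (0 \<in> s ` {1..} \<and> \<not> avoiding_return {a} s)"
proof (cases "0 \<in> s ` {1..}")
  case False
  then have "\<not> (1 \<le> m \<and> s m = 0)" for m unfolding zero_mem_later_iff by (simp only: One_nat_def Suc_le_eq) blast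
  then have none: "{enat m |m. 1 \<le> m \<and> s m = 0} = {}" by blast
  have "hitting_time 0 s = \<infinity>" unfolding hitting_time_def none by (simp add: top_enat_def)
  then have "sites_upto s (hitting_time 0 s) = range s" by (auto simp: sites_upto_def)
  then show ?thesis using False by blast
next
  case True
  have "{a} \<inter> A = {} \<longleftrightarrow> a \<notin> A" for A by blast
  then show ?thesis using True unfolding avoiding_return_def by blast
qed

context lattice_walk
begin

text \<open>Avoiding \<open>B\<close> is a condition on the past and one on the future separately,
  so independence and \<open>prob_returns_avoiding\<close> evaluate each term. The right-hand side
  serves as a normal form at which \<open>prob_aux_walks\<close> arrives too.\<close>

lemma prob_limit_event:
  "\<P>(z in S \<Otimes>\<^sub>M S. limit_event b q (partial_sums (snd z)) (\<lambda>m. - partial_sums (fst z) m))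
    = (let h = \<lambda>B. \<P>(x in S. (b \<longrightarrow> 0 \<notin> (\<lambda>m. - partial_sums x m) ` {1..}) \<and> B \<inter> range (\<lambda>m. - partial_sums x m) = {})
        * (\<P>(x in S. avoiding_return B (partial_sums x)) ^ q * \<P>(x in S. avoiding_escape B (partial_sums x)))
      in h {} - (\<Sum>B\<in>Pow (nbhd 0). (- 1) ^ card B * h B))"
proof -
  interpret PP: pair_prob_space S S ..
  let ?f = "\<lambda>z. partial_sums (snd z)" and ?g = "\<lambda>z m. - partial_sums (fst z) m"
  let ?E = "\<lambda>z. returns q (?f z) \<and> (b \<longrightarrow> 0 \<notin> ?g z ` {1..})"
  let ?U = "\<lambda>z. range (?f z) \<union> range (?g z)"
  define h where "h B = \<P>(x in S. (b \<longrightarrow> 0 \<notin> (\<lambda>m. - partial_sums x m) ` {1..}) \<and> B \<inter> range (\<lambda>m. - partial_sums x m) = {})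
        * (\<P>(x in S. avoiding_return B (partial_sums x)) ^ q * \<P>(x in S. avoiding_escape B (partial_sums x)))" for B
  have past: "Measurable.pred path_space (\<lambda>s :: nat \<Rightarrow> int ^ 'd. b \<longrightarrow> 0 \<notin> s ` {1..})"
    using pred_avoiding_past[of b "{}"] by simp
  have Em: "Measurable.pred (S \<Otimes>\<^sub>M S) ?E"
    by (rule pred_conj[OF measurable_compose[OF measurable_future pred_returns]
          measurable_compose[OF measurable_past past]])
  have Um: "Measurable.pred (S \<Otimes>\<^sub>M S) (\<lambda>z. a \<in> ?U z)" for a
    unfolding Un_iff
    by (intro pred_intros_logic measurable_compose[OF measurable_past pred_mem_image]
        measurable_compose[OF measurable_future pred_mem_image])
  have neg: "(\<lambda>x m. - partial_sums x m) \<in> S \<rightarrow>\<^sub>M path_space"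
    by (rule measurable_compose[OF measurable_partial_sums measurable_uminus_path])
  have h: "\<P>(z in S \<Otimes>\<^sub>M S. ?E z \<and> B \<inter> ?U z = {}) = h B" for B
  proof -
    let ?A = "\<lambda>x. (b \<longrightarrow> 0 \<notin> (\<lambda>m. - partial_sums x m) ` {1..}) \<and> B \<inter> range (\<lambda>m. - partial_sums x m) = {}"
    let ?R = "\<lambda>x. returns q (partial_sums x) \<and> B \<inter> range (partial_sums x) = {}"
    have split: "?E z \<and> B \<inter> ?U z = {} \<longleftrightarrow> ?A (fst z) \<and> ?R (snd z)" for z
      unfolding Int_Un_distrib Un_empty by blast
    have "\<P>(z in S \<Otimes>\<^sub>M S. ?E z \<and> B \<inter> ?U z = {}) = \<P>(z in S \<Otimes>\<^sub>M S. ?A (fst z) \<and> ?R (snd z))"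
      by (simp only: split)
    also have "\<dots> = \<P>(x in S. ?A x) * \<P>(x in S. ?R x)"
    proof (rule prob_pair_indep)
      show "Measurable.pred S ?A" by (rule measurable_compose[OF neg pred_avoiding_past])
      show "Measurable.pred S ?R"
        by (rule measurable_compose[OF measurable_partial_sums]) (intro pred_intros_logic pred_returns pred_avoid)
    qed
    finally show ?thesis unfolding prob_returns_avoiding h_def .
  qed
  have limit: "limit_event b q (?f z) (?g z) \<longleftrightarrow> ?E z \<and> \<not> nbhd 0 \<subseteq> ?U z" for z
    unfolding limit_event_def by blast
  have "\<P>(z in S \<Otimes>\<^sub>M S. limit_event b q (?f z) (?g z)) = \<P>(z in S \<Otimes>\<^sub>M S. ?E z \<and> \<not> nbhd 0 \<subseteq> ?U z)"
    by (simp only: limit)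
  also have "\<dots> = h {} - (\<Sum>B\<in>Pow (nbhd 0). (- 1) ^ card B * h B)"
    unfolding PP.prob_not_covering[OF finite_nbhd Em Um] h ..
  finally show ?thesis unfolding Let_def h_def .
qed

text \<open>For each \<open>B\<close>, avoidance is one condition per walk, so the probability is a
  product over labels: an escape for the walk, the past condition for the dual walk, a return for
  each copy. These are the factors into which a single walk with \<open>q\<close> returns and its
  past decompose, so inclusion-exclusion gives the same value.\<close>

lemma prob_aux_walks:
  fixes N :: "'a measure" and W W' :: "'a \<Rightarrow> nat \<Rightarrow> int ^ 'd" and C :: "nat \<Rightarrow> 'a \<Rightarrow> nat \<Rightarrow> int ^ 'd"
  assumes "prob_space N" and aux: "aux_walks N W W' C"
    and law: "distr N path_space W = distr S path_space partial_sums"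
  shows "\<P>(\<omega> in N. (0 \<notin> W \<omega> ` {1..} \<and> (b \<longrightarrow> 0 \<notin> W' \<omega> ` {1..}) \<and> (\<forall>i\<in>{1..q}. 0 \<in> C i \<omega> ` {1..}))
      \<and> \<not> nbhd 0 \<subseteq> range (W \<omega>) \<union> range (W' \<omega>) \<union> (\<Union>i\<in>{1..q}. sites_upto (C i \<omega>) (hitting_time 0 (C i \<omega>))))
    = \<P>(z in S \<Otimes>\<^sub>M S. limit_event b q (partial_sums (snd z)) (\<lambda>m. - partial_sums (fst z) m))"
proof -
  interpret N: prob_space N by fact
  define V where "V l = (case l of Original \<Rightarrow> W | Dual \<Rightarrow> W' | Copy i \<Rightarrow> C i)" for l
  define J where "J = {Original, Dual} \<union> Copy ` {1..q}"
  have indep: "N.indep_vars (\<lambda>_. path_space) V ({Original, Dual} \<union> Copy ` {1..})"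
    and law': "distr N path_space W' = distr N path_space (\<lambda>\<omega> m. - W \<omega> m)"
    and lawC: "\<And>i. i \<ge> 1 \<Longrightarrow> distr N path_space (C i) = distr N path_space W"
    using aux unfolding aux_walks_def V_def by blast+
  have Vm: "V l \<in> N \<rightarrow>\<^sub>M path_space" if "l \<in> {Original, Dual} \<union> Copy ` {1..}" for l
    using indep that unfolding N.indep_vars_def by blast
  have Wm: "W \<in> N \<rightarrow>\<^sub>M path_space" using Vm[of Original] by (simp add: V_def)
  have W'm: "W' \<in> N \<rightarrow>\<^sub>M path_space" using Vm[of Dual] by (simp add: V_def)
  have Cm: "C i \<in> N \<rightarrow>\<^sub>M path_space" if "i \<ge> 1" for i using Vm[of "Copy i"] that by (simp add: V_def)
  have prob_law: "\<P>(\<omega> in N. P (W \<omega>)) = \<P>(x in S. P (partial_sums x))" if "Measurable.pred path_space P" for P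
    using measure_distr_Collect[OF Wm that] measure_distr_Collect[OF measurable_partial_sums that] law by simp
  define past where "past B s \<longleftrightarrow> (b \<longrightarrow> 0 \<notin> s ` {1..}) \<and> B \<inter> range s = {}" for B and s :: "nat \<Rightarrow> int ^ 'd"
  have past: "Measurable.pred path_space (past B)" for B
    unfolding past_def[abs_def] by (rule pred_avoiding_past)
  let ?E = "\<lambda>\<omega>. 0 \<notin> W \<omega> ` {1..} \<and> (b \<longrightarrow> 0 \<notin> W' \<omega> ` {1..}) \<and> (\<forall>i\<in>{1..q}. 0 \<in> C i \<omega> ` {1..})"
  let ?U = "\<lambda>\<omega>. range (W \<omega>) \<union> range (W' \<omega>) \<union> (\<Union>i\<in>{1..q}. sites_upto (C i \<omega>) (hitting_time 0 (C i \<omega>)))"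
  define h where "h B = \<P>(x in S. (b \<longrightarrow> 0 \<notin> (\<lambda>m. - partial_sums x m) ` {1..}) \<and> B \<inter> range (\<lambda>m. - partial_sums x m) = {})
        * (\<P>(x in S. avoiding_return B (partial_sums x)) ^ q * \<P>(x in S. avoiding_escape B (partial_sums x)))" for B
  have h: "\<P>(\<omega> in N. ?E \<omega> \<and> B \<inter> ?U \<omega> = {}) = h B" for B
  proof -
    define Z where "Z l = {s. (case l of Original \<Rightarrow> avoiding_escape B | Dual \<Rightarrow> past B | Copy i \<Rightarrow> avoiding_return B) s}" for l
    have Z: "Z l \<in> sets path_space" for l
      using pred_avoiding_escape[of B] past[of B] pred_avoiding_return[of B]
      by (cases l) (simp_all add: Z_def pred_def)
    let ?K = "\<lambda>\<omega>. avoiding_escape B (W \<omega>) \<and> past B (W' \<omega>) \<and> (\<forall>i\<in>{1..q}. avoiding_return B (C i \<omega>))"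
    have 1: "?E \<omega> \<and> B \<inter> ?U \<omega> = {} \<longleftrightarrow> ?K \<omega>" for \<omega>
      unfolding avoiding_escape_def past_def avoiding_return_def Int_Un_distrib Un_empty by blast
    have 2: "?K \<omega> \<longleftrightarrow> (\<forall>l\<in>J. V l \<omega> \<in> Z l)" for \<omega>
      unfolding J_def ball_Un ball_simps V_def Z_def by simp
    \<comment> \<open>Nonemptiness of \<open>J\<close> keeps the intersection of preimages inside
      \<open>space N\<close>.\<close>
    have "Original \<in> J" by (simp add: J_def)
    then have 3: "{\<omega> \<in> space N. \<forall>l\<in>J. V l \<omega> \<in> Z l} = (\<Inter>l\<in>J. V l -` Z l \<inter> space N)" by blast
    have "N.prob (\<Inter>l\<in>J. V l -` Z l \<inter> space N) = (\<Prod>l\<in>J. N.prob (V l -` Z l \<inter> space N))"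
      by (rule N.indep_varsD[OF indep _ _ _ Z]) (auto simp: J_def)
    then have "\<P>(\<omega> in N. ?E \<omega> \<and> B \<inter> ?U \<omega> = {}) = (\<Prod>l\<in>J. N.prob (V l -` Z l \<inter> space N))"
      unfolding 1 2 3 .
    also have "\<dots> = N.prob (V Original -` Z Original \<inter> space N) * (N.prob (V Dual -` Z Dual \<inter> space N)
        * (\<Prod>i\<in>{1..q}. N.prob (V (Copy i) -` Z (Copy i) \<inter> space N)))"
    proof -
      have "J = insert Original (insert Dual (Copy ` {1..q}))" by (simp add: J_def)
      moreover have "inj_on Copy {1..q}" by (simp add: inj_on_def)
      moreover have "Original \<notin> insert Dual (Copy ` {1..q})" "Dual \<notin> Copy ` {1..q}" by auto
      ultimately show ?thesis by (simp add: prod.reindex)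
    qed
    also have "N.prob (V Original -` Z Original \<inter> space N) = \<P>(x in S. avoiding_escape B (partial_sums x))"
      using prob_law[OF pred_avoiding_escape[of B]] by (simp add: V_def Z_def vimage_def Int_def conj_commute)
    also have "N.prob (V Dual -` Z Dual \<inter> space N) = \<P>(x in S. past B (\<lambda>m. - partial_sums x m))"
    proof -
      have neg: "(\<lambda>\<omega> m. - W \<omega> m) \<in> N \<rightarrow>\<^sub>M path_space"
        by (rule measurable_compose[OF Wm measurable_uminus_path])
      have "\<P>(\<omega> in N. past B (W' \<omega>)) = \<P>(\<omega> in N. past B (\<lambda>m. - W \<omega> m))"
        using measure_distr_Collect[OF W'm past[of B]] measure_distr_Collect[OF neg past[of B]] law' by simp
      also have "\<dots> = \<P>(x in S. past B (\<lambda>m. - partial_sums x m))"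
        by (rule prob_law[OF measurable_compose[OF measurable_uminus_path past]])
      finally show ?thesis by (simp add: V_def Z_def vimage_def Int_def conj_commute)
    qed
    also have "(\<Prod>i\<in>{1..q}. N.prob (V (Copy i) -` Z (Copy i) \<inter> space N))
        = (\<Prod>i\<in>{1..q}. \<P>(x in S. avoiding_return B (partial_sums x)))"
    proof (rule prod.cong)
      fix i assume "i \<in> {1..q}"
      then have i: "i \<ge> 1" by simp
      have "\<P>(\<omega> in N. avoiding_return B (C i \<omega>)) = \<P>(\<omega> in N. avoiding_return B (W \<omega>))"
        using measure_distr_Collect[OF Cm[OF i] pred_avoiding_return[of B]]
          measure_distr_Collect[OF Wm pred_avoiding_return[of B]] lawC[OF i] by simp
      also have "\<dots> = \<P>(x in S. avoiding_return B (partial_sums x))"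
        by (rule prob_law[OF pred_avoiding_return])
      finally show "N.prob (V (Copy i) -` Z (Copy i) \<inter> space N) = \<P>(x in S. avoiding_return B (partial_sums x))"
        by (simp add: V_def Z_def vimage_def Int_def conj_commute)
    qed simp
    finally show ?thesis by (simp add: h_def past_def)
  qed
  have Em: "Measurable.pred N ?E"
  proof -
    have "Measurable.pred N (\<lambda>\<omega>. 0 \<notin> W \<omega> ` {1..})"
      by (intro pred_intros_logic measurable_compose[OF Wm pred_mem_image])
    moreover have "Measurable.pred N (\<lambda>\<omega>. b \<longrightarrow> 0 \<notin> W' \<omega> ` {1..})"
      using measurable_compose[OF W'm past[of "{}"]] by (simp add: past_def)
    moreover have "Measurable.pred N (\<lambda>\<omega>. \<forall>i\<in>{1..q}. 0 \<in> C i \<omega> ` {1..})"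
      by (intro measurable_pred_countable countable_set_type measurable_compose[OF Cm pred_mem_image]) simp
    ultimately show ?thesis by (intro pred_conj)
  qed
  have Um: "Measurable.pred N (\<lambda>\<omega>. a \<in> ?U \<omega>)" for a
  proof -
    have "Measurable.pred path_space (\<lambda>s. a \<in> sites_upto s (hitting_time 0 s))"
    proof -
      show ?thesis unfolding mem_sites_upto_iff
        by (intro pred_intros_logic pred_mem_image pred_avoiding_return)
    qed
    then have "Measurable.pred N (\<lambda>\<omega>. \<exists>i\<in>{1..q}. a \<in> sites_upto (C i \<omega>) (hitting_time 0 (C i \<omega>)))"
      by (intro measurable_pred_countable countable_set_type measurable_compose[OF Cm]) auto
    then show ?thesis
      unfolding Un_iff UN_iff
      by (intro pred_intros_logic measurable_compose[OF Wm pred_mem_image] measurable_compose[OF W'm pred_mem_image])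
  qed
  show ?thesis
    unfolding N.prob_not_covering[OF finite_nbhd Em Um] h prob_limit_event Let_def h_def ..
qed

end

section \<open>Transfer from the given increments to the product space\<close>

lemma (in prob_space) distr_iid_sequence:
  assumes "iid M X"
  shows "distr M (Pi\<^sub>M UNIV (\<lambda>_. distr M (count_space UNIV) (X 1))) (\<lambda>\<omega> i. X (Suc i) \<omega>)
      = Pi\<^sub>M UNIV (\<lambda>_. distr M (count_space UNIV) (X 1))"
    and "(\<lambda>\<omega> i. X (Suc i) \<omega>) \<in> M \<rightarrow>\<^sub>M Pi\<^sub>M UNIV (\<lambda>_. distr M (count_space UNIV) (X 1))"
proof -
  let ?D = "distr M (count_space UNIV) (X 1)"
  have X: "indep_vars (\<lambda>_. count_space UNIV) X {1..}"
    and law: "\<And>i. i \<ge> 1 \<Longrightarrow> distr M (count_space UNIV) (X i) = ?D"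
    using assms unfolding iid_def by blast+
  have Xm: "X (Suc i) \<in> M \<rightarrow>\<^sub>M count_space UNIV" for i
    using X unfolding indep_vars_def by auto
  have sets: "sets (Pi\<^sub>M UNIV (\<lambda>_::nat. ?D)) = sets (Pi\<^sub>M UNIV (\<lambda>_. count_space UNIV))"
    by (intro sets_PiM_cong) auto
  have indep: "indep_vars (\<lambda>_. count_space UNIV) (\<lambda>i. X (Suc i)) UNIV"
  proof -
    have "indep_sets (\<lambda>i. {X (Suc i) -` A \<inter> space M |A. A \<in> sets (count_space UNIV)}) UNIV"
    proof (rule indep_setsI)
      fix F J assume J: "J \<noteq> {}" "finite J"
        "\<forall>j\<in>J. F j \<in> {X (Suc j) -` A \<inter> space M |A. A \<in> sets (count_space UNIV)}"
      then have "\<forall>j\<in>J. \<exists>A. F j = X (Suc j) -` A \<inter> space M" by blast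
      from bchoice[OF this] obtain A where "\<forall>j\<in>J. F j = X (Suc j) -` A j \<inter> space M" by blast
      then have A: "F j = X (Suc j) -` A j \<inter> space M" if "j \<in> J" for j using that by blast
      \<comment> \<open>The given increments are indexed from 1 and the coordinates from 0. The
        argument \<open>i - 1\<close> undoes \<open>Suc\<close>, so the product formula for
        \<open>X\<close> can be read off on the image of \<open>J\<close>.\<close>
      have "prob (\<Inter>i\<in>Suc ` J. X i -` A (i - 1) \<inter> space M) = (\<Prod>i\<in>Suc ` J. prob (X i -` A (i - 1) \<inter> space M))"
        using J by (intro indep_varsD[OF X]) auto
      moreover have "(\<Inter>i\<in>Suc ` J. X i -` A (i - 1) \<inter> space M) = (\<Inter>j\<in>J. F j)"
        unfolding image_image diff_Suc_1 by (intro INF_cong refl) (simp only: A)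
      moreover have "(\<Prod>i\<in>Suc ` J. prob (X i -` A (i - 1) \<inter> space M)) = (\<Prod>j\<in>J. prob (F j))"
        by (subst prod.reindex) (simp_all add: A)
      ultimately show "prob (\<Inter>j\<in>J. F j) = (\<Prod>j\<in>J. prob (F j))" by simp
    next
      fix i
      show "{X (Suc i) -` A \<inter> space M |A. A \<in> sets (count_space UNIV)} \<subseteq> events"
        using measurable_sets[OF Xm] by blast
    qed
    then show ?thesis using Xm unfolding indep_vars_def2 by blast
  qed
  show "(\<lambda>\<omega> i. X (Suc i) \<omega>) \<in> M \<rightarrow>\<^sub>M Pi\<^sub>M UNIV (\<lambda>_. ?D)"
    by (rule measurable_PiM_single') (use Xm in auto)
  have "distr M (Pi\<^sub>M UNIV (\<lambda>_. ?D)) (\<lambda>\<omega> i. X (Suc i) \<omega>)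
      = distr M (Pi\<^sub>M UNIV (\<lambda>_. count_space UNIV)) (\<lambda>\<omega>. \<lambda>i\<in>UNIV. X (Suc i) \<omega>)"
    using sets by (intro distr_cong) auto
  also have "\<dots> = Pi\<^sub>M UNIV (\<lambda>i. distr M (count_space UNIV) (X (Suc i)))"
    using indep by (subst (asm) indep_vars_iff_distr_eq_PiM[OF _ Xm]) auto
  also have "\<dots> = Pi\<^sub>M UNIV (\<lambda>_. ?D)" by (intro PiM_cong refl law) simp
  finally show "distr M (Pi\<^sub>M UNIV (\<lambda>_. ?D)) (\<lambda>\<omega> i. X (Suc i) \<omega>) = Pi\<^sub>M UNIV (\<lambda>_. ?D)" .
qed

lemma walk_eq_partial_sums: "walk X \<omega> = partial_sums (\<lambda>i. X (Suc i) \<omega>)"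
proof
  fix k show "walk X \<omega> k = partial_sums (\<lambda>i. X (Suc i) \<omega>) k"
    unfolding walk_def partial_sums_def One_nat_def by (rule sum.atLeast1_atMost_eq)
qed

theorem theorem2p2:
  fixes M :: "'a measure"
    and X :: "nat \<Rightarrow> 'a \<Rightarrow> int ^ 'd"
    and S S' :: "'a \<Rightarrow> nat \<Rightarrow> int ^ 'd"
    and C :: "nat \<Rightarrow> 'a \<Rightarrow> nat \<Rightarrow> int ^ 'd"
    and p :: nat
  assumes "prob_space M"
    and "iid M X"
    and "S = walk X"
    and "aux_walks M S S' C"
    and "p \<ge> 1"
  shows
    "(AE \<omega> in M. (\<lambda>n. real (J_exactly p (S \<omega>) n) / real n) \<longlonglongrightarrow>
        \<P>(\<omega>' in M.
          \<not> nbhd 0 \<subseteq> range (S \<omega>') \<union> range (S' \<omega>')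
              \<union> (\<Union>i\<in>{1..p-1}. sites_upto (C i \<omega>') (hitting_time 0 (C i \<omega>')))
          \<and> 0 \<notin> S \<omega>' ` {1..} \<union> S' \<omega>' ` {1..}
          \<and> (\<forall>i\<in>{1..p-1}. 0 \<in> C i \<omega>' ` {1..})))
     \<and>
     (AE \<omega> in M. (\<lambda>n. real (J_atleast p (S \<omega>) n) / real n) \<longlonglongrightarrow>
        \<P>(\<omega>' in M.
          \<not> nbhd 0 \<subseteq> range (S \<omega>') \<union> range (S' \<omega>')
              \<union> (\<Union>i\<in>{1..p-1}. sites_upto (C i \<omega>') (hitting_time 0 (C i \<omega>')))
          \<and> 0 \<notin> S \<omega>' ` {1..}
          \<and> (\<forall>i\<in>{1..p-1}. 0 \<in> C i \<omega>' ` {1..})))"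
proof -
  interpret M: prob_space M by fact
  define D where "D = distr M (count_space UNIV) (X 1)"
  define \<xi> where "\<xi> = (\<lambda>\<omega> i. X (Suc i) \<omega>)"
  have "X 1 \<in> M \<rightarrow>\<^sub>M count_space UNIV" using assms(2) unfolding iid_def M.indep_vars_def by auto
  then have "prob_space D" unfolding D_def by (rule M.prob_space_distr)
  then interpret D: lattice_walk D
    by (intro lattice_walk.intro sequence_space.intro product_prob_spaceI lattice_walk_axioms.intro) (simp_all add: D_def)
  have \<xi>: "distr M D.S \<xi> = D.S" "\<xi> \<in> M \<rightarrow>\<^sub>M D.S"
    using M.distr_iid_sequence[OF assms(2)] unfolding D_def \<xi>_def .
  have S: "S = (\<lambda>\<omega>. partial_sums (\<xi> \<omega>))" unfolding assms(3) \<xi>_def by (rule ext) (rule walk_eq_partial_sums)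
  have "distr M path_space S = distr (distr M D.S \<xi>) path_space partial_sums"
    unfolding S using distr_distr[OF D.measurable_partial_sums \<xi>(2)] by (simp add: comp_def)
  then have law: "distr M path_space S = distr D.S path_space partial_sums" unfolding \<xi>(1) .
  obtain q where q: "p = Suc q" using assms(5) by (cases p) auto
  let ?cover = "\<lambda>\<omega>. nbhd 0 \<subseteq> range (S \<omega>) \<union> range (S' \<omega>)
      \<union> (\<Union>i\<in>{1..q}. sites_upto (C i \<omega>) (hitting_time 0 (C i \<omega>)))"
  let ?P = "\<lambda>b. \<P>(\<omega> in M. (0 \<notin> S \<omega> ` {1..} \<and> (b \<longrightarrow> 0 \<notin> S' \<omega> ` {1..}) \<and> (\<forall>i\<in>{1..q}. 0 \<in> C i \<omega> ` {1..})) \<and> \<not> ?cover \<omega>)"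
  \<comment> \<open>The flag treats both claims at once: \<open>True\<close> yields exactly
    \<open>p\<close> visits and includes the dual walk in the ban on returns, \<open>False\<close>
    yields at least \<open>p\<close> visits without that ban.\<close>
  have main: "AE \<omega> in M. (\<lambda>n. real (card (last_visits b q (S \<omega>) n)) / real n) \<longlonglongrightarrow> ?P b" for b
  proof -
    \<comment> \<open>The increments have the product measure as their law, so the almost sure
      statement there pulls back to \<open>M\<close>, with the limit rewritten by means of the
      auxiliary walks.\<close>
    have "AE x in distr M D.S \<xi>. (\<lambda>n. real (card (last_visits b q (partial_sums x) n)) / real n) \<longlonglongrightarrow> ?P b"
      unfolding \<xi>(1) D.prob_aux_walks[OF assms(1,4) law] by (rule D.last_visits_frequency)
    from AE_distrD[OF \<xi>(2) this] show ?thesis unfolding S .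
  qed
  have ex: "card (last_visits True q s n) = J_exactly p s n" for s :: "nat \<Rightarrow> int ^ 'd" and n
    using J_eq_card_last_visits[of True q s n] q by simp
  have al: "card (last_visits False q s n) = J_atleast p s n" for s :: "nat \<Rightarrow> int ^ 'd" and n
    using J_eq_card_last_visits[of False q s n] q by simp
  have P1: "?P True = \<P>(\<omega> in M. \<not> ?cover \<omega> \<and> 0 \<notin> S \<omega> ` {1..} \<union> S' \<omega> ` {1..} \<and> (\<forall>i\<in>{1..q}. 0 \<in> C i \<omega> ` {1..}))"
    by (rule arg_cong[where f="measure M"]) blast
  have P2: "?P False = \<P>(\<omega> in M. \<not> ?cover \<omega> \<and> 0 \<notin> S \<omega> ` {1..} \<and> (\<forall>i\<in>{1..q}. 0 \<in> C i \<omega> ` {1..}))"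
    by (rule arg_cong[where f="measure M"]) blast
  have q1: "p - 1 = q" by (simp add: q)
  show ?thesis
    using main[of True] main[of False] unfolding P1 P2 ex al q1 by (rule conjI)
qed

end
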